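(* Let $\alpha,\beta\in\mathbb{R}^2\setminus\{0\}$, $r_i^+>0$, $-\infty<r_i^-<r_i^+<\infty$, $i=1,2$. If the sets $D_{\alpha,r_1^-,r_1^+}$ and $D_{\beta,r_2^-,r_2^+}$ are of different types (one rational and the other irrational), then there is no proper holomorphic mapping $D_{\alpha,r_1^-,r_1^+}\to D_{\beta,r_2^-,r_2^+}$.
   Context: For $\alpha=(\alpha_1,\alpha_2)\in\mathbb{R}^2\setminus\{0\}$, $0<r^+<\infty$ and $-\infty<r^-<r^+$, put $D_{\alpha,r^-,r^+}:=\{z\in\mathbb{C}^2:\ r^-<|z^\alpha|<r^+\}$, where $|z^\alpha|=|z_1|^{\alpha_1}|z_2|^{\alpha_2}$ for those $z=(z_1,z_2)$ for which it makes sense (so $z_j\ne0$ if $\alpha_j<0$; $|z_j|^0=1$). The domain $D_{\alpha,r^-,r^+}$ is of the irrational type if $\alpha_1/\alpha_2\in\mathbb{R}\setminus\mathbb{Q}$, and of the rational type otherwise (including $\alpha_2=0$). *)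

theory Defs
  imports "HOL-Analysis.Analysis"
begin

text \<open>The base is meant to be nonnegative. In the library \<open>0 powr 0 = 0\<close>, whereas here
  \<open>0\<close> to the power \<open>0\<close> has to be \<open>1\<close>.\<close>

definition rpow :: "real \<Rightarrow> real \<Rightarrow> real" where
  "rpow t a = (if a = 0 then 1 else t powr a)"

definition monomial_defined :: "real^2 \<Rightarrow> complex^2 \<Rightarrow> bool" where
  "monomial_defined \<alpha> z \<longleftrightarrow> (\<forall>j. \<alpha> $ j < 0 \<longrightarrow> z $ j \<noteq> 0)"

definition abs_monomial :: "real^2 \<Rightarrow> complex^2 \<Rightarrow> real" where
  "abs_monomial \<alpha> z = rpow (cmod (z $ 1)) (\<alpha> $ 1) * rpow (cmod (z $ 2)) (\<alpha> $ 2)"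

text \<open>The lower bound \<open>r\<close> may be negative; then points with \<open>abs_monomial \<alpha> z = 0\<close>
  belong to the domain.\<close>

definition reinhardt_domain :: "real^2 \<Rightarrow> real \<Rightarrow> real \<Rightarrow> (complex^2) set" where
  "reinhardt_domain \<alpha> r R =
     {z. monomial_defined \<alpha> z \<and> r < abs_monomial \<alpha> z \<and> abs_monomial \<alpha> z < R}"

definition irrational_type :: "real^2 \<Rightarrow> bool" where
  "irrational_type \<alpha> \<longleftrightarrow> \<alpha> $ 2 \<noteq> 0 \<and> \<alpha> $ 1 / \<alpha> $ 2 \<notin> \<rat>"

definition rational_type :: "real^2 \<Rightarrow> bool" where
  "rational_type \<alpha> \<longleftrightarrow> \<not> irrational_type \<alpha>"

text \<open>Holomorphy in several variables (used on open sets): the real Frechet derivative exists at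
  every point and is complex linear, i.e. given by a complex Jacobian matrix \<open>J\<close>.\<close>

definition holomorphic_map_on :: "(complex^'n \<Rightarrow> complex^'m) \<Rightarrow> (complex^'n) set \<Rightarrow> bool" where
  "holomorphic_map_on f S \<longleftrightarrow>
     (\<forall>z\<in>S. \<exists>J :: complex^'n^'m. (f has_derivative (\<lambda>v. J *v v)) (at z within S))"

text \<open>Values of \<open>f\<close> outside \<open>S\<close> are irrelevant.\<close>

definition proper_holomorphic_map ::
  "(complex^'n) set \<Rightarrow> (complex^'m) set \<Rightarrow> (complex^'n \<Rightarrow> complex^'m) \<Rightarrow> bool" where
  "proper_holomorphic_map S T f \<longleftrightarrow>
     holomorphic_map_on f S \<and> f ` S \<subseteq> T \<and>
     (\<forall>K. compact K \<and> K \<subseteq> T \<longrightarrow> compact {z \<in> S. f z \<in> K})"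

end

theory Submission
  imports Defs "HOL-Complex_Analysis.Complex_Singularities"
begin

text \<open>
  The domains differ in the complex curves on which the modulus of the monomial is constant. Every
  point \<open>(a, b)\<close> of the domain off the axes lies on such an entire curve,
  \<open>\<zeta> \<mapsto> (a e\<^bsup>\<alpha>2 \<zeta>\<^esup>, b e\<^bsup>-\<alpha>1 \<zeta>\<^esup>)\<close>. For irrational \<open>\<alpha>\<close> these
  curves wind densely in the real hypersurfaces \<open>|z\<^sup>\<alpha>| = const\<close>; for rational \<open>\<alpha>\<close> they close up to
  algebraic curves, parametrised by \<open>t \<mapsto> (a t\<^sup>m, b t\<^sup>n)\<close> on the punctured plane, that are closed in the
  domain (up to a puncture, when one exponent vanishes).

  Irrational source, rational target. Let \<open>\<beta> = s (p, q)\<close> with integers \<open>p, q\<close> and \<open>s > 0\<close>. Then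
  \<open>F = f\<^sub>1\<^sup>p f\<^sub>2\<^sup>q\<close> is a bounded holomorphic function, so by Liouville it is constant on the curves. In
  logarithmic coordinates \<open>F\<close> is a function of \<open>\<alpha>1 \<xi> + \<alpha>2 \<eta>\<close> alone, and as \<open>\<xi>\<close> and \<open>\<eta>\<close> matter only
  modulo \<open>2 \<pi> \<i>\<close>, this function of one variable has the incommensurable periods \<open>2 \<pi> \<i> \<alpha>1\<close> and
  \<open>2 \<pi> \<i> \<alpha>2\<close>. Hence \<open>F\<close> is constant (\<open>holomorphic_two_periods_constant\<close>) and \<open>f\<close> maps into a curve.
  A proper map cannot do that: a suitable linear function on the target takes each of its values only
  finitely often on the curve, so its pullback minus one of its values would have a nonempty compact
  zero set, and holomorphic functions of two variables have none (\<open>no_compact_zero_set\<close>).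

  Rational source, irrational target. If \<open>f\<^sub>1 f\<^sub>2\<close> vanishes identically, \<open>f\<close> maps into the axes and
  the previous argument applies. Otherwise choose a curve through a point with \<open>f\<^sub>1 f\<^sub>2 \<noteq> 0\<close> and let
  \<open>u\<^sub>1, u\<^sub>2\<close> be the components of \<open>f\<close> along it. The function
  \<open>|u\<^sub>1|\<^bsup>\<beta>1\<^esup> |u\<^sub>2|\<^bsup>\<beta>2\<^esup>\<close> is bounded, and a Liouville theorem for such products, which are
  moduli of multivalued holomorphic functions, shows that \<open>u\<^sub>1, u\<^sub>2\<close> have no zeros and that the
  product is constant (\<open>bounded_monomial_along_entire_curve\<close>). Properness makes
  \<open>{t. |u\<^sub>1 t| = |u\<^sub>1 1|}\<close> stay away from every end of the punctured plane at which the curve leaves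
  all compact subsets of the domain, so \<open>u\<^sub>1\<close> and \<open>u\<^sub>2\<close> have no essential singularity there. If \<open>k\<close>
  and \<open>l\<close> are their orders at the end, constancy of the product gives \<open>k \<beta>1 + l \<beta>2 = 0\<close>, and
  irrationality gives \<open>k = l = 0\<close>. So \<open>u\<^sub>1\<close> has a finite limit there. The only other kind of end is a puncture over which the curve
  extends inside the domain, and the limit exists by continuity. Hence \<open>u\<^sub>1\<close> is constant
  (\<open>balanced_pair_constant\<close>), which contradicts that \<open>|u\<^sub>1|\<close> avoids the value \<open>|u\<^sub>1 1|\<close> near infinity.
\<close>

section \<open>Holomorphic maps of two variables along curves\<close>

definition point2 :: "complex \<Rightarrow> complex \<Rightarrow> complex^2" where
  "point2 x y = (\<chi> j. if j = 1 then x else y)"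

lemma point2_nth [simp]: "point2 x y $ 1 = x" "point2 x y $ 2 = y"
  by (simp_all add: point2_def)

lemma point2_eta [simp]: "point2 (z $ 1) (z $ 2) = z"
  by (simp add: vec_eq_iff forall_2)

lemma point2_eq_iff: "z = point2 x y \<longleftrightarrow> z $ 1 = x \<and> z $ 2 = y"
  by (auto simp: vec_eq_iff forall_2)

lemma tendsto_point2 [tendsto_intros]:
  assumes "(g \<longlongrightarrow> x) F" "(h \<longlongrightarrow> y) F"
  shows "((\<lambda>t. point2 (g t) (h t)) \<longlongrightarrow> point2 x y) F"
  unfolding point2_def by (intro tendsto_vec_lambda) (auto intro: assms)

lemma continuous_on_point2 [continuous_intros]:
  assumes "continuous_on S g" "continuous_on S h"
  shows "continuous_on S (\<lambda>t. point2 (g t) (h t))"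
  using assms by (auto simp: continuous_on_def intro: tendsto_point2)

lemma has_derivative_point2:
  assumes "(g has_field_derivative g') (at t)" "(h has_field_derivative h') (at t)"
  shows "((\<lambda>t. point2 (g t) (h t)) has_derivative (\<lambda>d. point2 (g' * d) (h' * d))) (at t)"
proof -
  have "((\<lambda>t. axis 1 (g t) + axis 2 (h t) :: complex^2) has_derivative
         (\<lambda>d. axis 1 (g' * d) + axis 2 (h' * d))) (at t)"
  proof (intro has_derivative_add)
    have bl: "bounded_linear (axis j :: complex \<Rightarrow> complex^2)" for j
      unfolding linear_conv_bounded_linear[symmetric]
      by (intro linearI) (auto simp: vec_eq_iff axis_def)
    show "((\<lambda>t. axis 1 (g t) :: complex^2) has_derivative (\<lambda>d. axis 1 (g' * d))) (at t)"
      using bounded_linear.has_derivative[OF bl, of g "(*) g'"] assms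
      by (simp add: has_field_derivative_def)
    show "((\<lambda>t. axis 2 (h t) :: complex^2) has_derivative (\<lambda>d. axis 2 (h' * d))) (at t)"
      using bounded_linear.has_derivative[OF bl, of h "(*) h'"] assms
      by (simp add: has_field_derivative_def)
  qed
  moreover have "axis 1 x + axis 2 y = point2 x y" for x y
    by (simp add: vec_eq_iff forall_2 axis_def)
  ultimately show ?thesis by simp
qed

lemma holomorphic_map_continuous_on:
  "holomorphic_map_on f S \<Longrightarrow> continuous_on S f"
  unfolding holomorphic_map_on_def continuous_on_eq_continuous_within
  by (meson has_derivative_continuous)

text \<open>The link between the Jacobian notion of holomorphy and one-variable function theory: everything
  below restricts the map to complex curves.\<close>

lemma holomorphic_along_curve:
  fixes f :: "complex^2 \<Rightarrow> complex^'m"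
  assumes f: "holomorphic_map_on f U" and U: "open U" and W: "open W"
    and g: "g holomorphic_on W" and h: "h holomorphic_on W"
    and sub: "\<And>t. t \<in> W \<Longrightarrow> point2 (g t) (h t) \<in> U"
  shows "(\<lambda>t. f (point2 (g t) (h t)) $ i) holomorphic_on W"
  unfolding holomorphic_on_open[OF W]
proof
  fix t assume t: "t \<in> W"
  obtain J :: "complex^2^'m" where
    J: "(f has_derivative (\<lambda>v. J *v v)) (at (point2 (g t) (h t)))"
    using f sub[OF t] U unfolding holomorphic_map_on_def by (metis at_within_open)
  have gd: "(g has_field_derivative deriv g t) (at t)" and hd: "(h has_field_derivative deriv h t) (at t)"
    using g h W t by (auto intro: holomorphic_derivI)
  have "((\<lambda>t. f (point2 (g t) (h t))) has_derivative
         (\<lambda>d. J *v point2 (deriv g t * d) (deriv h t * d))) (at t)"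
    using has_derivative_compose[OF has_derivative_point2[OF gd hd] J] .
  then have "((\<lambda>t. f (point2 (g t) (h t)) $ i) has_derivative
         (\<lambda>d. (J *v point2 (deriv g t * d) (deriv h t * d)) $ i)) (at t)"
    by (rule bounded_linear.has_derivative[OF bounded_linear_vec_nth])
  moreover have "(\<lambda>d. (J *v point2 (deriv g t * d) (deriv h t * d)) $ i)
      = (*) (J $ i $ 1 * deriv g t + J $ i $ 2 * deriv h t)"
    by (auto simp: matrix_vector_mult_def sum_2 algebra_simps)
  ultimately show "\<exists>f'. ((\<lambda>t. f (point2 (g t) (h t)) $ i) has_field_derivative f') (at t)"
    unfolding has_field_derivative_def by metis
qed

section \<open>Compact zero sets in two variables\<close>

text \<open>Zeros of a holomorphic function of two variables propagate. At the zero that is extremal for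
  \<open>(Re z\<^sub>1, Re z\<^sub>2)\<close> in the lexicographic order, the slice \<open>z\<^sub>1 = a\<close> has an isolated zero, because
  there are none to the right of it in this slice. By the choice of the first coordinate, the slices
  \<open>z\<^sub>1 = a + \<epsilon>\<close> have none at all, but for small \<open>\<epsilon>\<close> the function there is much smaller at the centre
  of a disc than on its boundary, which the maximum principle for the reciprocal excludes.\<close>

lemma no_compact_zero_set:
  fixes h :: "complex^2 \<Rightarrow> complex"
  assumes U: "open U" and cont: "continuous_on U h"
    and slice: "\<And>c W. open W \<Longrightarrow> (\<And>t. t \<in> W \<Longrightarrow> point2 c t \<in> U) \<Longrightarrow>
                  (\<lambda>t. h (point2 c t)) holomorphic_on W"
    and compact: "compact {z \<in> U. h z = 0}"
  shows "{z \<in> U. h z = 0} = {}"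
proof (rule ccontr)
  define Z where "Z = {z \<in> U. h z = 0}"
  assume "{z \<in> U. h z = 0} \<noteq> {}"
  then have "Z \<noteq> {}" and cZ: "compact Z" using compact by (auto simp: Z_def)
  then obtain z1 where z1: "z1 \<in> Z" "\<And>z. z \<in> Z \<Longrightarrow> Re (z $ 1) \<le> Re (z1 $ 1)"
    using continuous_attains_sup[of Z "\<lambda>z. Re (z $ 1)"]
      continuous_on_Re[OF continuous_on_component[OF continuous_on_id]] by blast
  define Z' where "Z' = Z \<inter> {z. Re (z $ 1) = Re (z1 $ 1)}"
  have "compact Z'" unfolding Z'_def
    by (intro compact_Int_closed cZ closed_Collect_eq continuous_intros)
  moreover have "Z' \<noteq> {}" using z1 by (auto simp: Z'_def)
  ultimately obtain z0 where z0: "z0 \<in> Z'" "\<And>z. z \<in> Z' \<Longrightarrow> Re (z $ 2) \<le> Re (z0 $ 2)"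
    using continuous_attains_sup[of Z' "\<lambda>z. Re (z $ 2)"]
      continuous_on_Re[OF continuous_on_component[OF continuous_on_id]] by blast
  define a b where "a = z0 $ 1" and "b = z0 $ 2"
  have ab: "point2 a b = z0" by (simp add: a_def b_def)
  have abZ: "point2 a b \<in> Z" using z0 by (simp add: ab Z'_def)
  have right1: "point2 c t \<notin> Z" if "Re c > Re a" for c t
    using z1(2)[of "point2 c t"] z0(1) that by (auto simp: Z'_def a_def)
  have right2: "point2 a t \<notin> Z" if "Re t > Re b" for t
    using z0(2)[of "point2 a t"] z0(1) that by (auto simp: Z'_def a_def b_def)
  obtain r where r: "r > 0" "\<And>x y. dist x a < r \<Longrightarrow> dist y b < r \<Longrightarrow> point2 x y \<in> U"
  proof -
    have "((\<lambda>p. point2 (fst p) (snd p)) \<longlongrightarrow> point2 a b) (nhds (a, b))"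
      by (intro tendsto_intros) (auto intro!: tendsto_eq_intros filterlim_ident)
    then have "eventually (\<lambda>p. point2 (fst p) (snd p) \<in> U) (nhds (a,b))"
      using abZ U by (auto simp: Z_def intro: topological_tendstoD)
    then obtain e where "e > 0" and e: "\<And>p. dist p (a, b) < e \<Longrightarrow> point2 (fst p) (snd p) \<in> U"
      unfolding eventually_nhds_metric by auto
    have "point2 x y \<in> U" if "dist x a < e / 2" "dist y b < e / 2" for x y
    proof -
      have "dist (x, y) (a, b) \<le> dist x a + dist y b"
        unfolding dist_Pair_Pair by (rule sqrt_sum_squares_le_sum) auto
      then show ?thesis using e[of "(x, y)"] that by simp
    qed
    then show ?thesis using \<open>e > 0\<close> by (intro that[of "e / 2"]) auto
  qed
  have "(\<lambda>t. h (point2 a t)) holomorphic_on ball b r"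
    by (intro slice) (auto simp: r dist_commute)
  moreover have "h (point2 a b) = 0" using abZ by (simp add: Z_def)
  moreover have "b + of_real (r / 2) \<in> ball b r" using r(1) by (simp add: dist_norm)
  moreover have "h (point2 a (b + of_real (r / 2))) \<noteq> 0"
    using right2[of "b + of_real (r / 2)"] r(1) r(2)[of a "b + of_real (r / 2)"]
    by (auto simp: Z_def dist_norm)
  ultimately obtain s where s: "s > 0" "ball b s \<subseteq> ball b r"
      "\<And>t. t \<in> ball b s - {b} \<Longrightarrow> h (point2 a t) \<noteq> 0"
    using isolated_zeros[of "\<lambda>t. h (point2 a t)" "ball b r" b "b + of_real (r / 2)"] r(1) by auto
  define \<rho> where "\<rho> = s / 2"
  have \<rho>: "\<rho> > 0" "cball b \<rho> \<subseteq> ball b s" "cball b \<rho> \<subseteq> ball b r"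
    using s by (auto simp: \<rho>_def)
  have contb: "continuous_on (cball a (r/2) \<times> cball b \<rho>) (\<lambda>(x, t). h (point2 x t))"
    unfolding split_beta
    by (intro continuous_on_compose2[OF cont] continuous_intros) (use r \<rho>(3) in \<open>auto simp: dist_commute subset_iff\<close>)
  obtain t0 where t0: "t0 \<in> sphere b \<rho>"
      "\<And>t. t \<in> sphere b \<rho> \<Longrightarrow> cmod (h (point2 a t0)) \<le> cmod (h (point2 a t))"
  proof -
    have "continuous_on (sphere b \<rho>) (\<lambda>t. cmod (h (point2 a t)))"
      by (intro continuous_intros continuous_on_compose2[OF cont])
         (use r \<rho>(3) in \<open>auto simp: dist_commute subset_iff\<close>)
    moreover have "sphere b \<rho> \<noteq> {}" using \<rho> by simp
    ultimately show ?thesis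
      using continuous_attains_inf[of "sphere b \<rho>" "\<lambda>t. cmod (h (point2 a t))"] that by auto
  qed
  define \<delta> where "\<delta> = cmod (h (point2 a t0))"
  have \<delta>: "\<delta> > 0"
  proof -
    have "t0 \<in> ball b s - {b}" using t0(1) \<rho> by auto
    then show ?thesis using s(3)[of t0] by (simp add: \<delta>_def)
  qed
  have "uniformly_continuous_on (cball a (r/2) \<times> cball b \<rho>) (\<lambda>(x, t). h (point2 x t))"
    by (intro compact_uniformly_continuous contb compact_Times) auto
  then obtain d where d: "d > 0" and
    d': "\<And>p q. p \<in> cball a (r/2) \<times> cball b \<rho> \<Longrightarrow> q \<in> cball a (r/2) \<times> cball b \<rho> \<Longrightarrow> dist q p < d
       \<Longrightarrow> dist ((\<lambda>(x, t). h (point2 x t)) q) ((\<lambda>(x, t). h (point2 x t)) p) < \<delta> / 2"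
    unfolding uniformly_continuous_on_def using \<delta> by (meson half_gt_zero)
  define \<epsilon> where "\<epsilon> = min (r / 2) (d / 2)"
  define c where "c = a + of_real \<epsilon>"
  have \<epsilon>: "\<epsilon> > 0" "\<epsilon> \<le> r / 2" "\<epsilon> < d" using r d by (auto simp: \<epsilon>_def)
  have near: "dist (h (point2 c t)) (h (point2 a t)) < \<delta> / 2" if "t \<in> cball b \<rho>" for t
    using d'[of "(a, t)" "(c, t)"] that \<epsilon> r(1) by (auto simp: c_def dist_norm)
  have cU: "point2 c t \<in> U" if "t \<in> ball b r" for t
    using that \<epsilon> r by (auto simp: c_def dist_norm norm_minus_commute intro!: r(2))
  have nz: "h (point2 c t) \<noteq> 0" if "t \<in> ball b r" for t
    using right1[of c t] cU[OF that] \<epsilon> by (auto simp: Z_def c_def)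
  have holc: "(\<lambda>t. inverse (h (point2 c t))) holomorphic_on ball b r"
    by (intro holomorphic_intros slice cU nz) auto
  have "cmod (inverse (h (point2 c b))) \<le> inverse (\<delta> / 2)"
  proof (rule maximum_modulus_frontier[where f = "\<lambda>t. inverse (h (point2 c t))" and S = "cball b \<rho>"])
    show "(\<lambda>t. inverse (h (point2 c t))) holomorphic_on interior (cball b \<rho>)"
      using \<rho> by (intro holomorphic_on_subset[OF holc]) auto
    show "continuous_on (closure (cball b \<rho>)) (\<lambda>t. inverse (h (point2 c t)))"
      using \<rho> by (intro continuous_on_subset[OF holomorphic_on_imp_continuous_on[OF holc]]) auto
    show "cmod (inverse (h (point2 c t))) \<le> inverse (\<delta> / 2)" if "t \<in> frontier (cball b \<rho>)" for t
    proof -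
      have t: "t \<in> sphere b \<rho>" using that \<rho> by auto
      then have "\<delta> \<le> cmod (h (point2 a t))" using t0(2) by (simp add: \<delta>_def)
      moreover have "cmod (h (point2 a t)) \<le> cmod (h (point2 c t)) + dist (h (point2 c t)) (h (point2 a t))"
        unfolding dist_norm by (metis norm_minus_commute norm_triangle_sub)
      ultimately have "\<delta> / 2 \<le> cmod (h (point2 c t))" using near[of t] t by auto
      then show ?thesis
        using \<delta> le_imp_inverse_le[of "\<delta> / 2" "cmod (h (point2 c t))"] by (simp add: norm_inverse)
    qed
  qed (use \<rho> in auto)
  moreover have "cmod (h (point2 c b)) < \<delta> / 2"
    using near[of b] \<open>h (point2 a b) = 0\<close> \<rho> by (simp add: dist_norm)
  moreover have "cmod (h (point2 c b)) > 0" using nz[of b] r by simp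
  ultimately show False using \<delta> by (simp add: norm_inverse norm_divide field_simps)
qed

text \<open>The finitely many points of the image on one complex line form a compact set; its preimage is the
  zero set of a single holomorphic function on \<open>U\<close>.\<close>

lemma no_proper_map_into_curve:
  fixes f :: "complex^2 \<Rightarrow> complex^2"
  assumes U: "open U" and proper: "proper_holomorphic_map U T f" and z0: "z0 \<in> U"
    and fin: "finite {w \<in> f ` U. x * w $ 1 + y * w $ 2 = x * f z0 $ 1 + y * f z0 $ 2}"
  shows False
proof -
  have hol: "holomorphic_map_on f U" and fUT: "f ` U \<subseteq> T"
    using proper by (auto simp: proper_holomorphic_map_def)
  define h where "h z = x * f z $ 1 + y * f z $ 2 - (x * f z0 $ 1 + y * f z0 $ 2)" for z
  define K where "K = {w \<in> f ` U. x * w $ 1 + y * w $ 2 = x * f z0 $ 1 + y * f z0 $ 2}"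
  have "compact K" "K \<subseteq> T" using fin fUT by (auto simp: K_def intro: finite_imp_compact)
  then have "compact {z \<in> U. f z \<in> K}" using proper by (auto simp: proper_holomorphic_map_def)
  also have "{z \<in> U. f z \<in> K} = {z \<in> U. h z = 0}" by (auto simp: K_def h_def)
  finally have comp: "compact {z \<in> U. h z = 0}" .
  have "{z \<in> U. h z = 0} = {}"
  proof (rule no_compact_zero_set[OF U _ _ comp])
    show "continuous_on U h" unfolding h_def
      by (intro continuous_intros holomorphic_map_continuous_on hol)
    show "(\<lambda>t. h (point2 c t)) holomorphic_on W"
      if "open W" "\<And>t. t \<in> W \<Longrightarrow> point2 c t \<in> U" for c W
      unfolding h_def by (intro holomorphic_intros holomorphic_along_curve[OF hol U] that)
  qed
  then show False using z0 by (auto simp: h_def)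
qed

section \<open>A maximum principle for products of real powers of moduli\<close>

text \<open>Where both functions are nonzero, the product is locally the modulus of the holomorphic function
  \<open>exp (b1 log g1 + b2 log g2)\<close>. If the maximum over the disc exceeded \<open>B\<close>, then the compact set of
  maximum points would lie inside the disc, away from the zeros; near its point with greatest real
  part the product would be constant, and the set would continue to the right.\<close>

lemma max_principle_weighted_product:
  assumes hol: "g1 holomorphic_on ball z \<rho>" "g2 holomorphic_on ball z \<rho>"
    and cont: "continuous_on (cball z \<rho>) g1" "continuous_on (cball z \<rho>) g2"
    and b: "b1 > 0" "b2 > 0" and "0 \<le> B"
    and bound: "\<And>t. t \<in> sphere z \<rho> \<Longrightarrow> cmod (g1 t) powr b1 * cmod (g2 t) powr b2 \<le> B"
    and t: "t \<in> cball z \<rho>"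
  shows "cmod (g1 t) powr b1 * cmod (g2 t) powr b2 \<le> B"
proof (rule ccontr)
  define v where "v t = cmod (g1 t) powr b1 * cmod (g2 t) powr b2" for t
  assume "\<not> ?thesis"
  then have gtB: "v t > B" by (simp add: v_def)
  have contv: "continuous_on (cball z \<rho>) v"
    unfolding v_def by (intro continuous_intros continuous_on_powr' cont) (use b in auto)
  obtain m where m: "m \<in> cball z \<rho>" "\<And>s. s \<in> cball z \<rho> \<Longrightarrow> v s \<le> v m"
    using continuous_attains_sup[OF compact_cball _ contv] t by blast
  define X where "X = {s \<in> cball z \<rho>. v s = v m}"
  have "compact X"
  proof -
    have "closed X" unfolding X_def
      by (intro continuous_closed_preimage_constant contv) auto
    then show ?thesis
      using compact_Int_closed[of "cball z \<rho>" X] by (simp add: X_def Int_absorb1 subset_iff)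
  qed
  moreover have "X \<noteq> {}" using m by (auto simp: X_def)
  ultimately obtain t0 where t0: "t0 \<in> X" "\<And>s. s \<in> X \<Longrightarrow> Re s \<le> Re t0"
    using continuous_attains_sup[of X Re] continuous_on_Re[OF continuous_on_id] by blast
  have vt0: "v t0 = v m" "v t0 > B" using t0 m(2)[OF t] gtB by (auto simp: X_def)
  then have "t0 \<notin> sphere z \<rho>" using bound[of t0] by (force simp: v_def)
  then have t0b: "t0 \<in> ball z \<rho>" using t0(1) by (auto simp: X_def)
  have "v t0 \<noteq> 0" using vt0(2) \<open>0 \<le> B\<close> by simp
  then have "g1 t0 * g2 t0 \<noteq> 0" by (auto simp: v_def)
  moreover have "continuous_on (ball z \<rho>) (\<lambda>t. g1 t * g2 t)"
    by (intro continuous_intros holomorphic_on_imp_continuous_on hol)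
  then have "open (ball z \<rho> \<inter> (\<lambda>t. g1 t * g2 t) -` (- {0}))"
    by (intro continuous_open_preimage) auto
  ultimately obtain e where e: "e > 0" "ball t0 e \<subseteq> ball z \<rho> \<inter> (\<lambda>t. g1 t * g2 t) -` (- {0})"
    using t0b by (metis (no_types, lifting) ComplI IntI open_contains_ball singletonD vimageI)
  obtain L1 where L1: "L1 holomorphic_on ball t0 e" "\<And>t. t \<in> ball t0 e \<Longrightarrow> exp (L1 t) = g1 t"
    by (rule holomorphic_logarithm_exists[of "ball t0 e" g1 t0])
       (use e in \<open>auto intro: holomorphic_on_subset[OF hol(1)]\<close>)
  obtain L2 where L2: "L2 holomorphic_on ball t0 e" "\<And>t. t \<in> ball t0 e \<Longrightarrow> exp (L2 t) = g2 t"
    by (rule holomorphic_logarithm_exists[of "ball t0 e" g2 t0])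
       (use e in \<open>auto intro: holomorphic_on_subset[OF hol(2)]\<close>)
  define w where "w t = exp (of_real b1 * L1 t + of_real b2 * L2 t)" for t
  have w: "cmod (w t) = v t" if "t \<in> ball t0 e" for t
    unfolding v_def w_def L1(2)[OF that, symmetric] L2(2)[OF that, symmetric]
    by (simp add: powr_def exp_add norm_mult)
  have "w constant_on ball t0 e"
  proof (rule maximum_modulus_principle[where U = "ball t0 e" and \<xi> = t0])
    show "w holomorphic_on ball t0 e"
      unfolding w_def by (intro holomorphic_intros L1 L2)
    show "cmod (w s) \<le> cmod (w t0)" if "s \<in> ball t0 e" for s
      using w[OF that] w[of t0] e that m(2)[of s] vt0 by (auto simp: subset_iff)
  qed (use e in auto)
  moreover define t1 where "t1 = t0 + of_real (e / 2)"
  moreover have t1: "t1 \<in> ball t0 e" using e by (simp add: t1_def dist_norm)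
  ultimately have "w t1 = w t0" using e unfolding constant_on_def by (metis centre_in_ball)
  then have "v t1 = v m" using w[of t1] w[of t0] t1 e vt0 by simp
  moreover have "t1 \<in> cball z \<rho>" using t1 e by (auto simp: subset_iff less_imp_le)
  ultimately have "t1 \<in> X" by (simp add: X_def)
  then show False using t0(2)[of t1] e by (simp add: t1_def)
qed

text \<open>Dividing a zero \<open>z\<close> out of \<open>g1\<close> improves the bound on the circle of radius \<open>\<rho>\<close> about \<open>z\<close> to
  \<open>C / \<rho> powr b1\<close>, so the maximum principle, with \<open>\<rho>\<close> tending to infinity, makes the product
  with the quotient vanish, even at \<open>t0\<close>.\<close>

lemma bounded_weighted_product_zero_free:
  assumes hol: "g1 holomorphic_on UNIV" "g2 holomorphic_on UNIV"
    and b: "b1 > 0" "b2 > 0"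
    and bound: "\<And>t. cmod (g1 t) powr b1 * cmod (g2 t) powr b2 \<le> C"
    and t0: "g1 t0 \<noteq> 0" "g2 t0 \<noteq> 0"
  shows "g1 z \<noteq> 0"
proof
  assume z: "g1 z = 0"
  define h where "h t = (if t = z then deriv g1 z else (g1 t - g1 z) / (t - z))" for t
  have hol_h: "h holomorphic_on UNIV"
    unfolding h_def by (rule pole_lemma) (use hol in auto)
  define v where "v = cmod (h t0) powr b1 * cmod (g2 t0) powr b2"
  have "t0 \<noteq> z" using z t0 by auto
  then have v: "v > 0" using t0 z by (auto simp: v_def h_def)
  have "C \<ge> 0" using bound[of 0] by (meson order_trans mult_nonneg_nonneg powr_ge_zero)
  have le: "v \<le> C / \<rho> powr b1" if \<rho>: "\<rho> > dist z t0" for \<rho>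
    unfolding v_def
  proof (rule max_principle_weighted_product[of h z \<rho> g2 b1 b2 "C / \<rho> powr b1" t0])
    have "\<rho> > 0" using \<rho> by (meson le_less_trans zero_le_dist)
    then show "0 \<le> C / \<rho> powr b1" using \<open>C \<ge> 0\<close> by simp
    fix t assume t: "t \<in> sphere z \<rho>"
    then have "t \<noteq> z" "cmod (t - z) = \<rho>" using \<open>\<rho> > 0\<close> by (auto simp: dist_norm norm_minus_commute)
    then have "cmod (h t) = cmod (g1 t) / \<rho>" using z by (simp add: h_def norm_divide)
    then show "cmod (h t) powr b1 * cmod (g2 t) powr b2 \<le> C / \<rho> powr b1"
      using bound[of t] \<open>\<rho> > 0\<close> by (simp add: powr_divide divide_right_mono)
  qed (use \<rho> b hol hol_h in \<open>auto intro: holomorphic_on_subset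
        continuous_on_subset[OF holomorphic_on_imp_continuous_on]\<close>)
  have "((\<lambda>\<rho>. C / \<rho> powr b1) \<longlongrightarrow> 0) at_top"
    using b by real_asymp
  then have "eventually (\<lambda>\<rho>. C / \<rho> powr b1 < v) at_top" using v by (rule order_tendstoD)
  then have "eventually (\<lambda>\<rho>. C / \<rho> powr b1 < v \<and> \<rho> > dist z t0) at_top"
    using eventually_gt_at_top[of "dist z t0"] by (rule eventually_conj)
  then obtain \<rho> where "C / \<rho> powr b1 < v" "\<rho> > dist z t0"
    using eventually_happens trivial_limit_at_top_linorder by blast
  then show False using le[of \<rho>] by simp
qed

text \<open>Without zeros there are global logarithms, and the classical theorem of Liouville applies to the
  exponential of their combination.\<close>

lemma bounded_weighted_product_constant:
  assumes hol: "g1 holomorphic_on UNIV" "g2 holomorphic_on UNIV"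
    and b: "b1 > 0" "b2 > 0"
    and bound: "\<And>t. cmod (g1 t) powr b1 * cmod (g2 t) powr b2 \<le> C"
    and t0: "g1 t0 \<noteq> 0" "g2 t0 \<noteq> 0"
  shows "cmod (g1 z) powr b1 * cmod (g2 z) powr b2 = cmod (g1 t0) powr b1 * cmod (g2 t0) powr b2"
proof -
  have nz1: "g1 t \<noteq> 0" for t
    using bounded_weighted_product_zero_free[OF hol b bound t0] .
  have nz2: "g2 t \<noteq> 0" for t
    using bounded_weighted_product_zero_free[OF hol(2,1) b(2,1) _ t0(2,1)] bound
    by (metis mult.commute)
  obtain L1 where L1: "L1 holomorphic_on UNIV" "\<And>t. exp (L1 t) = g1 t"
    by (rule holomorphic_logarithm_exists[of UNIV g1 0]) (use hol nz1 in auto)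
  obtain L2 where L2: "L2 holomorphic_on UNIV" "\<And>t. exp (L2 t) = g2 t"
    by (rule holomorphic_logarithm_exists[of UNIV g2 0]) (use hol nz2 in auto)
  define w where "w t = exp (of_real b1 * L1 t + of_real b2 * L2 t)" for t
  have w: "cmod (w t) = cmod (g1 t) powr b1 * cmod (g2 t) powr b2" for t
    unfolding w_def L1(2)[symmetric] L2(2)[symmetric] by (simp add: powr_def exp_add norm_mult)
  have "w constant_on UNIV"
  proof (rule Liouville_theorem)
    show "w holomorphic_on UNIV" unfolding w_def by (intro holomorphic_intros L1 L2)
    show "bounded (range w)" unfolding bounded_iff using w bound by auto
  qed
  then show ?thesis unfolding w[symmetric] constant_on_def by auto
qed

section \<open>Pairs of functions with a balanced product of moduli on the punctured plane\<close>

text \<open>The punctured disc is connected, so the modulus stays on one side of \<open>A\<close>; thus \<open>u\<close> or its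
  reciprocal is bounded and the singularity is not essential.\<close>

lemma factor_of_modulus_avoiding:
  assumes r: "r > 0" and hol: "u holomorphic_on ball 0 r - {0}"
    and nz: "\<And>t. t \<in> ball 0 r - {0} \<Longrightarrow> u t \<noteq> 0"
    and A: "A > 0" and avoid: "\<And>t. t \<in> ball 0 r - {0} \<Longrightarrow> cmod (u t) \<noteq> A"
  obtains k g where "g 0 \<noteq> 0" "isCont g 0" "eventually (\<lambda>t. u t = g t * t powi k) (at 0)"
proof -
  have *: "\<exists>k g. g 0 \<noteq> 0 \<and> isCont g 0 \<and> eventually (\<lambda>t. w t = g t * t powi k) (at 0)"
    if w: "w holomorphic_on ball 0 r - {0}" "\<And>t. t \<in> ball 0 r - {0} \<Longrightarrow> w t \<noteq> 0"
      "\<And>t. t \<in> ball 0 r - {0} \<Longrightarrow> cmod (w t) \<le> B" for w B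
  proof -
    have ev: "eventually (\<lambda>t::complex. t \<in> ball 0 r - {0}) (at 0)"
      using r by (auto simp: eventually_at dist_commute intro!: exI[of _ r])
    have "isolated_singularity_at w 0"
      unfolding isolated_singularity_at_def
      using r w(1) by (intro exI[of _ r]) (simp add: analytic_on_open open_delete)
    moreover have "not_essential w 0"
    proof -
      have "\<exists>B. eventually (\<lambda>t. cmod (w t) \<le> B) (at 0)"
        by (rule exI[of _ B], rule eventually_mono[OF ev], rule w(3))
      then obtain G where G: "G holomorphic_on ball 0 r" "\<And>t. t \<in> ball 0 r - {0} \<Longrightarrow> G t = w t"
        using iffD2[OF holomorphic_on_extend_bounded[OF w(1)]] r
        by (metis centre_in_ball interior_ball)
      have "G \<midarrow>0\<rightarrow> G 0"
        using holomorphic_on_imp_continuous_on[OF G(1)] r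
        by (simp add: continuous_on_eq_continuous_at isCont_def)
      then have "w \<midarrow>0\<rightarrow> G 0"
        by (rule Lim_transform_eventually) (rule eventually_mono[OF ev], rule G(2))
      then show ?thesis unfolding not_essential_def by blast
    qed
    moreover have "\<exists>\<^sub>F t in at 0. w t \<noteq> 0"
      by (rule eventually_frequently[OF at_neq_bot]) (rule eventually_mono[OF ev], rule w(2))
    ultimately obtain g s n where g: "g 0 \<noteq> 0" "s > 0" "g holomorphic_on cball 0 s"
        "\<And>t. t \<in> cball 0 s - {0} \<Longrightarrow> w t = g t * (t - 0) powi n"
      using zorder_exist[of w 0] by blast
    have "isCont g 0"
      using holomorphic_on_imp_continuous_on[OF g(3)] g(2)
      by (intro continuous_on_interior[of "cball 0 s"]) auto
    moreover have "eventually (\<lambda>t. w t = g t * t powi n) (at 0)"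
      using g(2,4) by (auto simp: eventually_at dist_norm intro!: exI[of _ s])
    ultimately show ?thesis using g(1) by blast
  qed
  have "connected (ball (0::complex) r - {0})"
    by (intro connected_punctured_ball) auto
  then have conn: "connected ((\<lambda>t. cmod (u t)) ` (ball 0 r - {0}))"
    by (intro connected_continuous_image continuous_intros holomorphic_on_imp_continuous_on hol)
  consider "\<And>t. t \<in> ball 0 r - {0} \<Longrightarrow> cmod (u t) \<le> A"
    | "\<And>t. t \<in> ball 0 r - {0} \<Longrightarrow> cmod (u t) > A"
  proof -
    have "cmod (u t) \<le> A \<or> cmod (u s) > A" if "t \<in> ball 0 r - {0}" "s \<in> ball 0 r - {0}" for s t
    proof (rule ccontr)
      assume "\<not> ?thesis"
      then have "A \<in> (\<lambda>t. cmod (u t)) ` (ball 0 r - {0})"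
        using connectedD_interval[OF conn, of "cmod (u s)" "cmod (u t)" A] that by simp
      then show False using avoid by blast
    qed
    then show ?thesis using that by (metis not_le)
  qed
  then show ?thesis
  proof cases
    case 1
    then show ?thesis using *[OF hol nz] that by blast
  next
    case 2
    have "\<exists>k g. g 0 \<noteq> 0 \<and> isCont g 0 \<and> eventually (\<lambda>t. inverse (u t) = g t * t powi k) (at 0)"
    proof (rule *)
      show "cmod (inverse (u t)) \<le> inverse A" if "t \<in> ball 0 r - {0}" for t
        using 2[OF that] A by (simp add: norm_inverse le_imp_inverse_le)
    qed (use nz in \<open>auto intro!: holomorphic_intros hol\<close>)
    then obtain k g where g: "g 0 \<noteq> 0" "isCont g 0"
      "eventually (\<lambda>t. inverse (u t) = g t * t powi k) (at 0)" by blast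
    have "eventually (\<lambda>t. u t = inverse (g t) * t powi (- k)) (at 0)"
      using g(3) by eventually_elim (metis inverse_inverse_eq inverse_mult_distrib power_int_minus)
    with g show ?thesis
      by (intro that[of "\<lambda>t. inverse (g t)" "-k"]) (auto intro!: continuous_intros)
  qed
qed

text \<open>Both functions have finite orders \<open>k, l\<close> at the puncture, and the modulus equation forces
  \<open>k \<beta>1 + l \<beta>2 = 0\<close>. As the weights are incommensurable, both orders vanish.\<close>

lemma limit_of_balanced_pair:
  fixes \<beta>1 \<beta>2 :: real
  assumes r: "r > 0"
    and hol: "u1 holomorphic_on ball 0 r - {0}" "u2 holomorphic_on ball 0 r - {0}"
    and nz: "\<And>t. t \<in> ball 0 r - {0} \<Longrightarrow> u1 t \<noteq> 0 \<and> u2 t \<noteq> 0"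
    and A: "A1 > 0" "A2 > 0"
    and eq: "\<And>t. t \<in> ball 0 r - {0} \<Longrightarrow>
               cmod (u1 t) powr \<beta>1 * cmod (u2 t) powr \<beta>2 = A1 powr \<beta>1 * A2 powr \<beta>2"
    and avoid: "\<And>t. t \<in> ball 0 r - {0} \<Longrightarrow> cmod (u1 t) \<noteq> A1"
    and irr: "\<beta>2 \<noteq> 0" "\<beta>1 / \<beta>2 \<notin> \<rat>"
  obtains l where "u1 \<midarrow>0\<rightarrow> l"
proof -
  have "\<beta>1 \<noteq> 0" using irr by auto
  have avoid2: "cmod (u2 t) \<noteq> A2" if t: "t \<in> ball 0 r - {0}" for t
  proof
    assume "cmod (u2 t) = A2"
    then have "cmod (u1 t) powr \<beta>1 = A1 powr \<beta>1" using eq[OF t] A by simp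
    then have "(cmod (u1 t) powr \<beta>1) powr (1 / \<beta>1) = (A1 powr \<beta>1) powr (1 / \<beta>1)" by simp
    then have "cmod (u1 t) = A1" using \<open>\<beta>1 \<noteq> 0\<close> nz[OF t] A by (simp add: powr_powr)
    then show False using avoid[OF t] by simp
  qed
  obtain k g1 where g1: "g1 0 \<noteq> 0" "isCont g1 0" "eventually (\<lambda>t. u1 t = g1 t * t powi k) (at 0)"
    using factor_of_modulus_avoiding[OF r hol(1) _ A(1) avoid] nz by blast
  obtain l g2 where g2: "g2 0 \<noteq> 0" "isCont g2 0" "eventually (\<lambda>t. u2 t = g2 t * t powi l) (at 0)"
    using factor_of_modulus_avoiding[OF r hol(2) _ A(2) avoid2] nz by blast
  define e where "e = of_int k * \<beta>1 + of_int l * \<beta>2"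
  define P where "P t = cmod (g1 t) powr \<beta>1 * cmod (g2 t) powr \<beta>2" for t
  define C where "C = A1 powr \<beta>1 * A2 powr \<beta>2"
  have "C > 0" using A by (simp add: C_def)
  have "P 0 > 0" using g1 g2 by (simp add: P_def)
  have P: "(P \<longlongrightarrow> P 0) (at 0)"
    unfolding P_def using g1 g2 by (intro tendsto_intros) (auto simp: isCont_def)
  have ev: "eventually (\<lambda>t::complex. t \<in> ball 0 r - {0}) (at 0)"
    using r by (auto simp: eventually_at dist_commute intro!: exI[of _ r])
  have "eventually (\<lambda>t. P t * cmod t powr e = C) (at 0)"
    using ev g1(3) g2(3)
  proof eventually_elim
    case (elim t)
    then have "t \<noteq> 0" by auto
    have pw: "cmod (t powi n) powr b = cmod t powr (of_int n * b)" for n b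
      using \<open>t \<noteq> 0\<close> by (simp add: norm_power_int powr_powr flip: powr_real_of_int')
    show ?case
      using eq[OF elim(1)] unfolding elim(2,3) C_def P_def e_def
      by (simp add: norm_mult powr_mult pw powr_add mult_ac)
  qed
  note Pe = this
  have to0: "((\<lambda>t::complex. cmod t powr a) \<longlongrightarrow> 0) (at 0)" if "a > 0" for a
  proof -
    have "((\<lambda>t::complex. cmod t powr a) \<longlongrightarrow> 0 powr a) (at 0)"
      by (intro tendsto_powr' tendsto_norm_zero tendsto_const tendsto_ident_at) (use that in auto)
    then show ?thesis by simp
  qed
  \<comment> \<open>A nonzero \<open>e\<close> would let the constant \<open>C\<close> or the positive limit of \<open>P\<close> tend to zero.\<close>
  have "\<not> e > 0"
  proof
    assume "e > 0"
    have "((\<lambda>t. P t * cmod t powr e) \<longlongrightarrow> P 0 * 0) (at 0)" by (intro tendsto_intros P to0 \<open>e > 0\<close>)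
    moreover have "((\<lambda>t. P t * cmod t powr e) \<longlongrightarrow> C) (at 0)"
      using Pe by (rule tendsto_eventually)
    ultimately have "P 0 * 0 = C" by (rule tendsto_unique[OF at_neq_bot])
    then show False using \<open>C > 0\<close> by simp
  qed
  moreover have "\<not> - e > 0"
  proof
    assume "- e > 0"
    have "eventually (\<lambda>t. C * cmod t powr (- e) = P t) (at 0)"
      using Pe ev by eventually_elim (auto simp: powr_minus field_simps)
    moreover have "((\<lambda>t. C * cmod t powr (- e)) \<longlongrightarrow> C * 0) (at 0)"
      by (intro tendsto_intros to0 \<open>- e > 0\<close>)
    ultimately have "(P \<longlongrightarrow> C * 0) (at 0)" by (rule Lim_transform_eventually[rotated])
    then have "P 0 = C * 0" using P by (intro tendsto_unique[OF at_neq_bot])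
    then show False using \<open>P 0 > 0\<close> by simp
  qed
  ultimately have "e = 0" by simp
  have "k = 0"
  proof (rule ccontr)
    assume "k \<noteq> 0"
    then have "\<beta>1 / \<beta>2 = - of_int l / of_int k"
      using \<open>e = 0\<close> irr(1) unfolding e_def by (simp add: field_simps)
    then show False using irr(2) by simp
  qed
  then have "eventually (\<lambda>t. g1 t = u1 t) (at 0)" using g1(3) by (auto elim: eventually_mono)
  then have "u1 \<midarrow>0\<rightarrow> g1 0"
    using g1(2) unfolding isCont_def by (rule Lim_transform_eventually[rotated])
  then show ?thesis by (rule that)
qed

text \<open>A Liouville theorem on the punctured plane. At the origin, the existence of a limit may also be
  given in advance; this alternative serves the curves that extend over their puncture.\<close>

lemma balanced_pair_constant:
  fixes \<beta>1 \<beta>2 :: real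
  assumes hol: "u1 holomorphic_on - {0}" "u2 holomorphic_on - {0}"
    and nz: "\<And>t. t \<noteq> 0 \<Longrightarrow> u1 t \<noteq> 0 \<and> u2 t \<noteq> 0"
    and A: "A1 > 0" "A2 > 0"
    and eq: "\<And>t. t \<noteq> 0 \<Longrightarrow>
               cmod (u1 t) powr \<beta>1 * cmod (u2 t) powr \<beta>2 = A1 powr \<beta>1 * A2 powr \<beta>2"
    and irr: "\<beta>2 \<noteq> 0" "\<beta>1 / \<beta>2 \<notin> \<rat>"
    and outer: "M > 0" "\<And>t. cmod t > M \<Longrightarrow> cmod (u1 t) \<noteq> A1"
    and inner: "(\<exists>l. u1 \<midarrow>0\<rightarrow> l) \<or> (\<exists>m>0. \<forall>t. t \<noteq> 0 \<longrightarrow> cmod t < m \<longrightarrow> cmod (u1 t) \<noteq> A1)"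
  obtains l where "\<And>t. t \<noteq> 0 \<Longrightarrow> u1 t = l"
proof -
  obtain l0 where l0: "u1 \<midarrow>0\<rightarrow> l0"
  proof -
    consider l where "u1 \<midarrow>0\<rightarrow> l"
      | m where "m > 0" "\<And>t. t \<noteq> 0 \<Longrightarrow> cmod t < m \<Longrightarrow> cmod (u1 t) \<noteq> A1"
      using inner by blast
    then show ?thesis
    proof cases
      case 2
      have "u1 holomorphic_on ball 0 m - {0}" "u2 holomorphic_on ball 0 m - {0}"
        by (auto intro: holomorphic_on_subset[OF hol(1)] holomorphic_on_subset[OF hol(2)])
      then show ?thesis
        by (rule limit_of_balanced_pair[OF 2(1) _ _ _ A _ _ irr]) (use nz eq 2 that in auto)
    qed (rule that)
  qed
  have sub: "inverse t \<noteq> 0" "cmod (inverse t) > M" if "t \<in> ball 0 (1 / M) - {0}" for t :: complex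
    using that outer(1) by (auto simp: norm_inverse norm_divide field_simps)
  have hol': "(\<lambda>t. u (inverse t)) holomorphic_on ball 0 (1 / M) - {0}" if "u holomorphic_on - {0}" for u
  proof -
    have "inverse holomorphic_on ball (0::complex) (1 / M) - {0}"
      using holomorphic_on_inverse[OF holomorphic_on_ident, of "ball 0 (1 / M) - {0}"] by auto
    moreover have "inverse ` (ball (0::complex) (1 / M) - {0}) \<subseteq> - {0}" by auto
    ultimately show ?thesis
      using holomorphic_on_compose_gen[of inverse "ball 0 (1 / M) - {0}" u "- {0}"] that
      by (simp add: o_def)
  qed
  obtain l where l: "(\<lambda>t. u1 (inverse t)) \<midarrow>0\<rightarrow> l"
  proof (rule limit_of_balanced_pair[OF _ hol'[OF hol(1)] hol'[OF hol(2)] _ A _ _ irr])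
    show "0 < 1 / M" using outer by simp
  qed (use sub nz eq outer(2) that in auto)
  define G where "G t = (if t = 0 then l0 else u1 t)" for t
  have "G holomorphic_on UNIV" unfolding G_def
    by (rule removable_singularity) (use hol l0 in \<open>auto simp: Compl_eq_Diff_UNIV\<close>)
  moreover have "(G \<longlongrightarrow> l) at_infinity"
  proof -
    have "(u1 \<longlongrightarrow> l) at_infinity" using l unfolding lim_at_infinity_0 by (simp add: o_def)
    moreover have "eventually (\<lambda>t. u1 t = G t) at_infinity"
      unfolding eventually_at_infinity G_def by (intro exI[of _ 1]) auto
    ultimately show ?thesis by (rule Lim_transform_eventually)
  qed
  ultimately have "G t = l" for t by (rule Liouville_weak)
  then show ?thesis using that[of l] by (metis G_def)
qed

section \<open>Monomial Reinhardt domains\<close>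

lemma open_reinhardt_domain: "open (reinhardt_domain \<alpha> r R)"
proof -
  have D: "monomial_defined \<alpha> = (\<lambda>z. (\<alpha> $ 1 < 0 \<longrightarrow> z $ 1 \<noteq> 0) \<and> (\<alpha> $ 2 < 0 \<longrightarrow> z $ 2 \<noteq> 0))"
    by (auto simp: fun_eq_iff monomial_defined_def forall_2)
  have "open {z. monomial_defined \<alpha> z}" unfolding D
    by (intro open_Collect_conj open_Collect_imp open_Collect_neq closed_Collect_const continuous_intros)
  moreover have "continuous_on {z. monomial_defined \<alpha> z} (\<lambda>z. rpow (cmod (z $ j)) (\<alpha> $ j))" for j
  proof (cases "\<alpha> $ j = 0")
    case False
    then have pos: "0 < \<alpha> $ j" if "monomial_defined \<alpha> z" "z $ j = 0" for z
      using that unfolding monomial_defined_def by (metis linorder_neqE)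
    have "continuous_on {z. monomial_defined \<alpha> z} (\<lambda>z. cmod (z $ j) powr (\<alpha> $ j))"
      by (intro continuous_on_powr' continuous_intros) (auto intro: pos)
    with False show ?thesis by (simp add: rpow_def)
  qed (simp add: rpow_def)
  then have "continuous_on {z. monomial_defined \<alpha> z} (abs_monomial \<alpha>)"
    unfolding abs_monomial_def by (intro continuous_intros)
  ultimately have "open ({z. monomial_defined \<alpha> z} \<inter> abs_monomial \<alpha> -` {r<..<R})"
    by (intro continuous_open_preimage) auto
  moreover have "{z. monomial_defined \<alpha> z} \<inter> abs_monomial \<alpha> -` {r<..<R} = reinhardt_domain \<alpha> r R"
    by (auto simp: reinhardt_domain_def)
  ultimately show ?thesis by simp
qed

text \<open>In logarithmic coordinates the domain becomes a strip on which the monomial depends on a linear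
  form only.\<close>

lemma abs_monomial_exp:
  "abs_monomial \<alpha> (point2 (exp \<xi>) (exp \<eta>)) = exp (\<alpha> $ 1 * Re \<xi> + \<alpha> $ 2 * Re \<eta>)"
  by (simp add: abs_monomial_def rpow_def powr_def exp_add)

lemma exp_in_reinhardt_domain_iff:
  "point2 (exp \<xi>) (exp \<eta>) \<in> reinhardt_domain \<alpha> r R \<longleftrightarrow>
     r < exp (\<alpha> $ 1 * Re \<xi> + \<alpha> $ 2 * Re \<eta>) \<and> exp (\<alpha> $ 1 * Re \<xi> + \<alpha> $ 2 * Re \<eta>) < R"
  by (auto simp: reinhardt_domain_def abs_monomial_exp monomial_defined_def forall_2)

lemma reinhardt_domain_exp_nonempty:
  assumes "\<alpha> \<noteq> 0" "R > 0" "r < R"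
  obtains \<xi> \<eta> where "point2 (exp \<xi>) (exp \<eta>) \<in> reinhardt_domain \<alpha> r R"
proof -
  obtain x where x: "max r 0 < x" "x < R" using dense[of "max r 0" R] assms by auto
  have "\<alpha> $ 1 \<noteq> 0 \<or> \<alpha> $ 2 \<noteq> 0" using assms(1) by (auto simp: vec_eq_iff forall_2)
  then consider "\<alpha> $ 1 \<noteq> 0" | "\<alpha> $ 2 \<noteq> 0" by blast
  then show ?thesis
  proof cases
    case 1
    then show ?thesis using x
      by (intro that[of "of_real (ln x / \<alpha> $ 1)" 0]) (simp add: exp_in_reinhardt_domain_iff del: exp_zero of_real_divide)
  next
    case 2
    then show ?thesis using x
      by (intro that[of 0 "of_real (ln x / \<alpha> $ 2)"]) (simp add: exp_in_reinhardt_domain_iff del: exp_zero of_real_divide)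
  qed
qed

lemma constant_off_axes_imp_constant:
  fixes h :: "complex^2 \<Rightarrow> complex"
  assumes U: "open U" and cont: "continuous_on U h"
    and const: "\<And>z. z \<in> U \<Longrightarrow> z $ 1 \<noteq> 0 \<Longrightarrow> z $ 2 \<noteq> 0 \<Longrightarrow> h z = c"
    and z: "z \<in> U"
  shows "h z = c"
proof -
  define \<gamma> where "\<gamma> t = point2 (z $ 1 + t) (z $ 2 + t)" for t
  have "(\<gamma> \<longlongrightarrow> point2 (z $ 1 + 0) (z $ 2 + 0)) (at 0)"
    unfolding \<gamma>_def by (intro tendsto_intros)
  then have \<gamma>: "(\<gamma> \<longlongrightarrow> z) (at 0)" by simp
  have evU: "eventually (\<lambda>t. \<gamma> t \<in> U) (at 0)"
    using \<gamma> U z by (rule topological_tendstoD)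
  have "isCont h z" using cont U z by (simp add: continuous_on_eq_continuous_at)
  then have "((\<lambda>t. h (\<gamma> t)) \<longlongrightarrow> h z) (at 0)" using \<gamma> by (rule isCont_tendsto_compose)
  moreover have "eventually (\<lambda>t. t \<noteq> - z $ 1) (at 0)" "eventually (\<lambda>t. t \<noteq> - z $ 2) (at 0)"
    by (rule eventually_neq_at_within)+
  with evU have "eventually (\<lambda>t. h (\<gamma> t) = c) (at 0)"
  proof eventually_elim
    case (elim t)
    then show ?case by (intro const) (auto simp: \<gamma>_def add_eq_0_iff)
  qed
  then have "((\<lambda>t. h (\<gamma> t)) \<longlongrightarrow> c) (at 0)" by (rule tendsto_eventually)
  ultimately show ?thesis by (rule tendsto_unique[OF at_neq_bot])
qed

lemma finite_power_int_roots:
  fixes c :: complex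
  assumes "n \<noteq> 0"
  shows "finite {z. z powi n = c}"
proof (cases "n > 0")
  case True
  then have "{z. z powi n = c} = {z. z ^ nat n = c}" by (simp add: power_int_def)
  then show ?thesis using True finite_nth_roots[of "nat n" c] by simp
next
  case False
  then have "{z. z powi n = c} = {z. z ^ nat (- n) = inverse c}"
    using assms by (auto simp: power_int_def power_inverse)
  then show ?thesis using False assms finite_nth_roots[of "nat (- n)" "inverse c"] by simp
qed

text \<open>On a level set of a monomial one coordinate determines the other up to roots, provided the given
  coordinate is invertible or has exponent zero. The level zero of a genuine product is the union of
  the axes, where the sum of the coordinates takes each value at most twice.\<close>

lemma no_proper_map_into_monomial_level:
  fixes f :: "complex^2 \<Rightarrow> complex^2" and p q :: int
  assumes U: "open U" "U \<noteq> {}" and proper: "proper_holomorphic_map U T f"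
    and pq: "p \<noteq> 0 \<or> q \<noteq> 0"
    and level: "\<And>z. z \<in> U \<Longrightarrow> (f z $ 1) powi p * (f z $ 2) powi q = c"
  shows False
proof -
  obtain z0 where z0: "z0 \<in> U" using U by auto
  consider "q \<noteq> 0" "c \<noteq> 0 \<or> p = 0" | "p \<noteq> 0" "c \<noteq> 0 \<or> q = 0" | "p \<noteq> 0" "q \<noteq> 0" "c = 0"
    using pq by blast
  then show False
  proof cases
    case 1
    define d where "d = f z0 $ 1"
    have "d powi p \<noteq> 0" using level[OF z0] 1 by (auto simp: d_def)
    then have "{w \<in> f ` U. w $ 1 = d} \<subseteq> point2 d ` {v. v powi q = c / d powi p}"
      using level by (force simp: image_iff point2_eq_iff field_simps)
    then have "finite {w \<in> f ` U. w $ 1 = d}"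
      using finite_power_int_roots[OF 1(1)] by (meson finite_imageI finite_subset)
    then show False
      using no_proper_map_into_curve[OF U(1) proper z0, of 1 0] by (simp add: d_def)
  next
    case 2
    define d where "d = f z0 $ 2"
    have "d powi q \<noteq> 0" using level[OF z0] 2 by (auto simp: d_def)
    then have "{w \<in> f ` U. w $ 2 = d} \<subseteq> (\<lambda>v. point2 v d) ` {v. v powi p = c / d powi q}"
      using level by (force simp: image_iff point2_eq_iff field_simps)
    then have "finite {w \<in> f ` U. w $ 2 = d}"
      using finite_power_int_roots[OF 2(1)] by (meson finite_imageI finite_subset)
    then show False
      using no_proper_map_into_curve[OF U(1) proper z0, of 0 1] by (simp add: d_def)
  next
    case 3
    define d where "d = f z0 $ 1 + f z0 $ 2"
    have "w $ 1 = 0 \<or> w $ 2 = 0" if "w \<in> f ` U" for w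
      using that level 3 by auto
    then have "{w \<in> f ` U. w $ 1 + w $ 2 = d} \<subseteq> {point2 d 0, point2 0 d}"
      by (force simp: point2_eq_iff)
    then have "finite {w \<in> f ` U. w $ 1 + w $ 2 = d}" by (rule finite_subset) simp
    then show False
      using no_proper_map_into_curve[OF U(1) proper z0, of 1 1] by (simp add: d_def)
  qed
qed

lemma rational_type_integer_exponents:
  assumes "rational_type \<alpha>" "\<alpha> \<noteq> 0"
  obtains s :: real and p q :: int where "s > 0" "\<alpha> $ 1 = s * of_int p" "\<alpha> $ 2 = s * of_int q"
    "p \<noteq> 0 \<or> q \<noteq> 0"
proof -
  have nz: "\<alpha> $ 1 \<noteq> 0 \<or> \<alpha> $ 2 \<noteq> 0" using assms(2) by (auto simp: vec_eq_iff forall_2)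
  note result = that
  have *: thesis if "s \<noteq> 0" "\<alpha> $ 1 = s * of_int p" "\<alpha> $ 2 = s * of_int q" for s p q
  proof (cases "s > 0")
    case True
    then show ?thesis using that nz by (intro result[of s p q]) auto
  next
    case False
    then show ?thesis
      using that nz by (intro result[of "-s" "-p" "-q"]) auto
  qed
  show thesis
  proof (cases "\<alpha> $ 2 = 0")
    case True
    then show ?thesis using *[of "\<alpha> $ 1" 1 0] nz by simp
  next
    case False
    then have "\<alpha> $ 1 / \<alpha> $ 2 \<in> \<rat>" using assms(1) by (simp add: rational_type_def irrational_type_def)
    then obtain m n :: int where mn: "n > 0" "\<alpha> $ 1 / \<alpha> $ 2 = of_int m / of_int n"
      by (elim Rats_cases') auto
    then show ?thesis using *[of "\<alpha> $ 2 / of_int n" m n] False by (simp add: field_simps)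
  qed
qed

lemma rpow_mult_of_int:
  assumes "x \<ge> 0" "s > 0"
  shows "rpow x (s * of_int p) = (x powi p) powr s"
proof (cases "p = 0 \<or> x = 0")
  case False
  then have "x powi p = x powr of_int p" using assms by (simp add: powr_real_of_int')
  then show ?thesis using False assms by (simp add: rpow_def powr_powr mult.commute)
qed (use assms in \<open>auto simp: rpow_def\<close>)

section \<open>From the irrational to the rational type\<close>

text \<open>By Kronecker's theorem in dimension one, multiples of \<open>a / b\<close> come arbitrarily close to integers.\<close>

lemma irrational_has_small_integer_combination:
  fixes a b :: real
  assumes "b \<noteq> 0" "a / b \<notin> \<rat>" "\<epsilon> > 0"
  obtains m n :: int where "of_int m * a + of_int n * b \<noteq> 0" "\<bar>of_int m * a + of_int n * b\<bar> < \<epsilon>"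
proof -
  obtain k :: nat where k: "k > 0" "\<bar>frac (real k * (a / b)) - 0\<bar> < \<epsilon> / \<bar>b\<bar>"
    using Kronecker_approx_1_explicit[of "a / b" 0 "\<epsilon> / \<bar>b\<bar>"] assms by auto
  define n where "n = - \<lfloor>real k * (a / b)\<rfloor>"
  have eq: "of_int (int k) * a + of_int n * b = b * frac (real k * (a / b))"
    using assms by (simp add: n_def frac_def field_simps)
  show ?thesis
  proof (rule that[of "int k" n])
    have "frac (real k * (a / b)) \<noteq> 0"
    proof
      assume "frac (real k * (a / b)) = 0"
      then have "real k * (a / b) \<in> \<int>" by simp
      then have "real k * (a / b) / real k \<in> \<rat>" using Ints_subset_Rats by (intro Rats_divide) auto
      then show False using assms k by simp
    qed
    then show "of_int (int k) * a + of_int n * b \<noteq> 0" unfolding eq using assms by simp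
    show "\<bar>of_int (int k) * a + of_int n * b\<bar> < \<epsilon>"
      unfolding eq using k assms by (simp add: abs_mult field_simps)
  qed
qed

text \<open>Arbitrarily small periods make every value be taken at points accumulating in the domain.\<close>

lemma holomorphic_two_periods_constant:
  fixes a b :: real and e :: "complex \<Rightarrow> complex"
  assumes hol: "e holomorphic_on S" and S: "open S" "connected S"
    and ab: "b \<noteq> 0" "a / b \<notin> \<rat>" and \<omega>: "\<omega> \<noteq> 0"
    and period: "\<And>s m n. s \<in> S \<Longrightarrow>
      s + \<omega> * of_real (of_int m * a + of_int n * b) \<in> S \<and>
      e (s + \<omega> * of_real (of_int m * a + of_int n * b)) = e s"
  shows "e constant_on S"
proof (rule ccontr)
  assume not: "\<not> e constant_on S"
  then obtain s0 where s0: "s0 \<in> S" by (auto simp: constant_on_def)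
  then obtain s1 where s1: "s1 \<in> S" "e s1 \<noteq> e s0" using not unfolding constant_on_def by metis
  have "(\<lambda>s. e s - e s0) holomorphic_on S" by (intro holomorphic_intros hol)
  then obtain \<rho> where \<rho>: "\<rho> > 0" "\<And>s. s \<in> ball s0 \<rho> - {s0} \<Longrightarrow> e s - e s0 \<noteq> 0"
    by (rule isolated_zeros[where \<xi> = s0 and \<beta> = s1]) (use S s0 s1 in auto)
  have "\<rho> / cmod \<omega> > 0" using \<rho> \<omega> by simp
  from irrational_has_small_integer_combination[OF ab this] obtain m n :: int
    where mn: "of_int m * a + of_int n * b \<noteq> 0" "\<bar>of_int m * a + of_int n * b\<bar> < \<rho> / cmod \<omega>" .
  define s where "s = s0 + \<omega> * of_real (of_int m * a + of_int n * b)"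
  have "cmod (s - s0) = cmod \<omega> * \<bar>of_int m * a + of_int n * b\<bar>"
    unfolding s_def add_diff_cancel_left' norm_mult norm_of_real ..
  also have "\<dots> < \<rho>" using mn(2) \<omega> by (simp add: field_simps)
  finally have "s \<in> ball s0 \<rho>" by (simp add: dist_norm norm_minus_commute)
  moreover have "s \<noteq> s0" unfolding s_def using mn(1) \<omega>
    by (metis add_cancel_right_right mult_eq_0_iff of_real_eq_0_iff)
  moreover have "e s = e s0" using period[OF s0] by (simp add: s_def)
  ultimately show False using \<rho>(2)[of s] by simp
qed

lemma no_proper_map_irrational_rational:
  assumes irr: "irrational_type \<alpha>" and rat: "rational_type \<beta>" and nz: "\<alpha> \<noteq> 0" "\<beta> \<noteq> 0"
    and R: "R1 > 0" "r1 < R1"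
    and proper: "proper_holomorphic_map (reinhardt_domain \<alpha> r1 R1) (reinhardt_domain \<beta> r2 R2) f"
  shows False
proof -
  define D where "D = reinhardt_domain \<alpha> r1 R1"
  define T where "T = reinhardt_domain \<beta> r2 R2"
  have oD: "open D" by (simp add: D_def open_reinhardt_domain)
  have proper: "proper_holomorphic_map D T f" using proper by (simp add: D_def T_def)
  then have hol: "holomorphic_map_on f D" and fT: "\<And>z. z \<in> D \<Longrightarrow> f z \<in> T"
    by (auto simp: proper_holomorphic_map_def)
  have \<alpha>2: "\<alpha> $ 2 \<noteq> 0" "\<alpha> $ 1 / \<alpha> $ 2 \<notin> \<rat>" using irr by (auto simp: irrational_type_def)
  then have \<alpha>1: "\<alpha> $ 1 \<noteq> 0" by auto
  obtain s p q where s: "s > 0" and pq: "\<beta> $ 1 = s * of_int p" "\<beta> $ 2 = s * of_int q"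
      "p \<noteq> 0 \<or> q \<noteq> 0"
    using rational_type_integer_exponents[OF rat nz(2)] .
  define F where "F z = (f z $ 1) powi p * (f z $ 2) powi q" for z
  have np: "p \<ge> 0 \<or> f z $ 1 \<noteq> 0" and nq: "q \<ge> 0 \<or> f z $ 2 \<noteq> 0" if "z \<in> D" for z
    using fT[OF that] s pq
    by (auto simp: T_def reinhardt_domain_def monomial_defined_def forall_2 mult_less_0_iff not_le)
  have bound: "cmod (F z) \<le> R2 powr (1 / s)" if "z \<in> D" for z
  proof -
    have "abs_monomial \<beta> (f z) = cmod (F z) powr s"
      using s by (simp add: abs_monomial_def pq rpow_mult_of_int F_def norm_mult norm_power_int powr_mult)
    then have "cmod (F z) powr s < R2" using fT[OF that] by (simp add: T_def reinhardt_domain_def)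
    then have "(cmod (F z) powr s) powr (1 / s) \<le> R2 powr (1 / s)"
      using s by (intro powr_mono2) auto
    then show ?thesis using s by (simp add: powr_powr)
  qed
  have holF: "(\<lambda>t. F (point2 (g t) (h t))) holomorphic_on W"
    if "open W" "g holomorphic_on W" "h holomorphic_on W" "\<And>t. t \<in> W \<Longrightarrow> point2 (g t) (h t) \<in> D"
    for W g h
    unfolding F_def
    by (intro holomorphic_on_mult holomorphic_on_power_int holomorphic_along_curve[OF hol oD] that)
       (use np nq that(4) in blast)+
  define S where "S = {w. r1 < exp (Re w) \<and> exp (Re w) < R1}"
  define e where "e w = F (point2 (exp (w / of_real (\<alpha> $ 1))) 1)" for w
  have expD: "point2 (exp \<xi>) (exp \<eta>) \<in> D \<longleftrightarrow> of_real (\<alpha> $ 1) * \<xi> + of_real (\<alpha> $ 2) * \<eta> \<in> S" for \<xi> \<eta>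
    by (simp add: D_def exp_in_reinhardt_domain_iff S_def)
  have Fe: "F (point2 (exp \<xi>) (exp \<eta>)) = e (of_real (\<alpha> $ 1) * \<xi> + of_real (\<alpha> $ 2) * \<eta>)"
    if D: "point2 (exp \<xi>) (exp \<eta>) \<in> D" for \<xi> \<eta>
  proof -
    define \<phi> where "\<phi> \<zeta> = F (point2 (exp (\<xi> + of_real (\<alpha> $ 2) * \<zeta>)) (exp (\<eta> - of_real (\<alpha> $ 1) * \<zeta>)))" for \<zeta>
    have inD: "point2 (exp (\<xi> + of_real (\<alpha> $ 2) * \<zeta>)) (exp (\<eta> - of_real (\<alpha> $ 1) * \<zeta>)) \<in> D" for \<zeta>
      using D unfolding expD by (simp add: algebra_simps)
    have "\<phi> constant_on UNIV"
    proof (rule Liouville_theorem)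
      show "\<phi> holomorphic_on UNIV"
        unfolding \<phi>_def by (intro holF inD holomorphic_intros) auto
      show "bounded (range \<phi>)"
        unfolding bounded_iff using bound inD by (auto simp: \<phi>_def)
    qed
    \<comment> \<open>this parameter moves the second coordinate to \<open>1\<close>\<close>
    then have "\<phi> 0 = \<phi> (\<eta> / of_real (\<alpha> $ 1))" by (auto simp: constant_on_def)
    then show ?thesis using \<alpha>1 by (simp add: \<phi>_def e_def add_divide_distrib)
  qed
  have e1: "e w = F (point2 (exp (w / of_real (\<alpha> $ 1))) (exp 0))" for w by (simp add: e_def)
  have baseD: "point2 (exp (w / of_real (\<alpha> $ 1))) (exp 0) \<in> D" if "w \<in> S" for w
    unfolding expD using that \<alpha>1 by simp
  have "e constant_on S"
  proof (rule holomorphic_two_periods_constant[OF _ _ _ \<alpha>2])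
    have S_eq: "S = Re -` {x. r1 < exp x \<and> exp x < R1}" by (auto simp: S_def)
    have "is_interval {x. r1 < exp x \<and> exp x < R1}"
      unfolding is_interval_1
    proof (intro ballI allI impI)
      fix x y z assume "x \<in> {x. r1 < exp x \<and> exp x < R1}" "y \<in> {x. r1 < exp x \<and> exp x < R1}"
        "x \<le> z \<and> z \<le> y"
      moreover from this have "exp x \<le> exp z" "exp z \<le> exp y" by auto
      ultimately show "z \<in> {x. r1 < exp x \<and> exp x < R1}"
        using less_le_trans[of r1 "exp x" "exp z"] le_less_trans[of "exp z" "exp y" R1] by simp
    qed
    then show "connected S" unfolding S_eq
      by (intro convex_connected convex_linear_vimage is_interval_convex bounded_linear.linear[OF bounded_linear_Re])
    show "open S" unfolding S_def
      by (intro open_Collect_conj open_Collect_less continuous_intros)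
    then show "e holomorphic_on S"
      unfolding e1 using \<alpha>1 by (intro holF holomorphic_intros baseD) auto
    show "2 * of_real pi * \<i> \<noteq> 0" by simp
    fix w :: complex and m n :: int assume w: "w \<in> S"
    define \<tau> where "\<tau> = 2 * of_real pi * \<i> * of_real (of_int m * \<alpha> $ 1 + of_int n * \<alpha> $ 2)"
    have "w + \<tau> \<in> S" using w by (simp add: S_def \<tau>_def)
    moreover have "e (w + \<tau>) = e w"
    proof -
      define \<xi> \<eta> where "\<xi> = w / of_real (\<alpha> $ 1) + 2 * of_real pi * \<i> * of_int m"
        and "\<eta> = 2 * of_real pi * \<i> * of_int n"
      have eq: "of_real (\<alpha> $ 1) * \<xi> + of_real (\<alpha> $ 2) * \<eta> = w + \<tau>"
        using \<alpha>1 by (simp add: \<xi>_def \<eta>_def \<tau>_def algebra_simps)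
      have "e (w + \<tau>) = F (point2 (exp \<xi>) (exp \<eta>))"
        using Fe[of \<xi> \<eta>] \<open>w + \<tau> \<in> S\<close> unfolding expD eq by simp
      moreover have "exp \<xi> = exp (w / of_real (\<alpha> $ 1))" "exp \<eta> = exp 0"
        unfolding exp_eq \<xi>_def \<eta>_def
        by (rule exI[of _ m], simp add: algebra_simps, rule exI[of _ n], simp add: algebra_simps)
      ultimately show ?thesis by (simp add: e_def)
    qed
    ultimately show "w + 2 * of_real pi * \<i> * of_real (of_int m * \<alpha> $ 1 + of_int n * \<alpha> $ 2) \<in> S \<and>
      e (w + 2 * of_real pi * \<i> * of_real (of_int m * \<alpha> $ 1 + of_int n * \<alpha> $ 2)) = e w"
      by (simp add: \<tau>_def)
  qed
  then obtain c where c: "\<And>w. w \<in> S \<Longrightarrow> e w = c" by (auto simp: constant_on_def)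
  have "F z = c" if "z \<in> D" for z
  proof (rule constant_off_axes_imp_constant[OF oD _ _ that])
    show "continuous_on D F" unfolding F_def
      by (intro continuous_intros holomorphic_map_continuous_on hol) (use np nq in blast)+
    fix z :: "complex^2" assume "z \<in> D" "z $ 1 \<noteq> 0" "z $ 2 \<noteq> 0"
    moreover from this have "z = point2 (exp (Ln (z $ 1))) (exp (Ln (z $ 2)))" by simp
    ultimately show "F z = c"
      using Fe[of "Ln (z $ 1)" "Ln (z $ 2)"] expD[of "Ln (z $ 1)" "Ln (z $ 2)"] c by simp
  qed
  moreover have "D \<noteq> {}" using reinhardt_domain_exp_nonempty[OF nz(1) R] unfolding D_def by blast
  ultimately show False
    using no_proper_map_into_monomial_level[OF oD _ proper pq(3), of c] unfolding F_def by blast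
qed

section \<open>From the rational to the irrational type\<close>

text \<open>A sufficient criterion, for nonzero \<open>a\<close> and \<open>b\<close>, for \<open>t \<mapsto> (a t\<^sup>m, b t\<^sup>n)\<close> to leave all compact subsets of the domain as \<open>t\<close> tends to
  infinity: a coordinate tends to infinity, or it tends to zero although its exponent in \<open>\<alpha>\<close> is
  negative, so that the axis is excluded from the domain. The behaviour as \<open>t\<close> tends to zero is that
  of the exponents \<open>- m, - n\<close>.\<close>

definition escapes :: "real^2 \<Rightarrow> int \<Rightarrow> int \<Rightarrow> bool" where
  "escapes \<alpha> m n \<longleftrightarrow> m > 0 \<or> n > 0 \<or> (m < 0 \<and> \<alpha> $ 1 < 0) \<or> (n < 0 \<and> \<alpha> $ 2 < 0)"

lemma escapes_leaves_compact:
  assumes K: "compact K" "K \<subseteq> reinhardt_domain \<alpha> r R" and ab: "a \<noteq> 0" "b \<noteq> 0"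
    and esc: "escapes \<alpha> m n"
  obtains M where "M > 0" "\<And>t. cmod t > M \<Longrightarrow> point2 (a * t powi m) (b * t powi n) \<notin> K"
proof -
  obtain B where B: "\<And>z. z \<in> K \<Longrightarrow> norm z \<le> B"
    using compact_imp_bounded[OF K(1)] by (auto simp: bounded_iff)
  have low: "\<exists>\<delta>>0. \<forall>z\<in>K. \<delta> \<le> cmod (z $ j)" if "\<alpha> $ j < 0" for j
  proof (cases "K = {}")
    case False
    have "continuous_on K (\<lambda>z. cmod (z $ j))" by (intro continuous_intros)
    then obtain z where z: "z \<in> K" "\<And>w. w \<in> K \<Longrightarrow> cmod (z $ j) \<le> cmod (w $ j)"
      using continuous_attains_inf[OF K(1) False, of "\<lambda>z. cmod (z $ j)"] by blast
    have "z $ j \<noteq> 0" using z(1) K(2) that by (auto simp: reinhardt_domain_def monomial_defined_def)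
    then show ?thesis using z(2) by (intro exI[of _ "cmod (z $ j)"]) auto
  qed (auto intro: exI[of _ 1])
  have big: "\<exists>M>0. \<forall>t. cmod t > M \<longrightarrow> (\<forall>z\<in>K. z $ j \<noteq> c * t powi k)"
    if "c \<noteq> 0" "k > 0" for j c k
  proof (intro exI conjI allI impI ballI notI)
    show "max 1 (B / cmod c) > 0" by simp
    fix t z assume t: "cmod t > max 1 (B / cmod c)" and z: "z \<in> K" "z $ j = c * t powi k"
    have "cmod t powi 1 \<le> cmod t powi k" using t that by (intro power_int_increasing) auto
    then have "cmod c * cmod t \<le> cmod (z $ j)"
      using z(2) that by (simp add: norm_mult norm_power_int mult_left_mono)
    also have "\<dots> \<le> B" by (rule order_trans[OF Finite_Cartesian_Product.norm_nth_le B[OF z(1)]])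
    finally show False using t that by (simp add: field_simps)
  qed
  have small: "\<exists>M>0. \<forall>t. cmod t > M \<longrightarrow> (\<forall>z\<in>K. z $ j \<noteq> c * t powi k)"
    if neg: "c \<noteq> 0" "k < 0" "\<alpha> $ j < 0" for j c k
  proof -
    obtain \<delta> where \<delta>: "\<delta> > 0" "\<And>z. z \<in> K \<Longrightarrow> \<delta> \<le> cmod (z $ j)" using low[OF neg(3)] by blast
    show ?thesis
    proof (intro exI conjI allI impI ballI notI)
      show "max 1 (cmod c / \<delta>) > 0" by simp
      fix t z assume t: "cmod t > max 1 (cmod c / \<delta>)" and z: "z \<in> K" "z $ j = c * t powi k"
      have "cmod t powi k \<le> cmod t powi (- 1)" using t that by (intro power_int_increasing) auto
      then have "cmod (z $ j) \<le> cmod c * inverse (cmod t)"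
        using z(2) that by (simp add: norm_mult norm_power_int mult_left_mono power_int_minus)
      then have "\<delta> \<le> cmod c * inverse (cmod t)" using \<delta>(2)[OF z(1)] by simp
      moreover have "cmod t > 0" "cmod c < \<delta> * cmod t" using t \<delta> by (auto simp: field_simps)
      ultimately show False by (simp add: field_simps)
    qed
  qed
  consider "m > 0 \<or> (m < 0 \<and> \<alpha> $ 1 < 0)" | "n > 0 \<or> (n < 0 \<and> \<alpha> $ 2 < 0)"
    using esc by (auto simp: escapes_def)
  then show ?thesis
  proof cases
    case 1
    then obtain M where "M > 0" "\<forall>t. cmod t > M \<longrightarrow> (\<forall>z\<in>K. z $ 1 \<noteq> a * t powi m)"
      using big[OF ab(1), of m 1] small[OF ab(1), of m 1] by blast
    then show ?thesis by (intro that[of M]) force+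
  next
    case 2
    then obtain M where "M > 0" "\<forall>t. cmod t > M \<longrightarrow> (\<forall>z\<in>K. z $ 2 \<noteq> b * t powi n)"
      using big[OF ab(2), of n 2] small[OF ab(2), of n 2] by blast
    then show ?thesis by (intro that[of M]) force+
  qed
qed

text \<open>A component with negative weight has no zeros, so its reciprocal is entire and has positive weight;
  the results on products with positive weights then apply.\<close>

lemma bounded_monomial_along_entire_curve:
  fixes u1 u2 :: "complex \<Rightarrow> complex" and \<beta>1 \<beta>2 :: real
  assumes hol: "u1 holomorphic_on UNIV" "u2 holomorphic_on UNIV"
    and \<beta>: "\<beta>1 \<noteq> 0" "\<beta>2 \<noteq> 0"
    and def1: "\<And>t. \<beta>1 < 0 \<Longrightarrow> u1 t \<noteq> 0" and def2: "\<And>t. \<beta>2 < 0 \<Longrightarrow> u2 t \<noteq> 0"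
    and bound: "\<And>t. cmod (u1 t) powr \<beta>1 * cmod (u2 t) powr \<beta>2 \<le> C"
    and t0: "u1 t0 \<noteq> 0" "u2 t0 \<noteq> 0"
  shows "u1 z \<noteq> 0 \<and> u2 z \<noteq> 0 \<and> cmod (u1 z) powr \<beta>1 * cmod (u2 z) powr \<beta>2
           = cmod (u1 t0) powr \<beta>1 * cmod (u2 t0) powr \<beta>2"
proof -
  define g where "g \<beta> u = (\<lambda>t. if \<beta> > 0 then u t else inverse (u t))"
    for \<beta> :: real and u :: "complex \<Rightarrow> complex"
  have hol_g: "g \<beta> u holomorphic_on UNIV"
    if "u holomorphic_on UNIV" "\<beta> \<noteq> 0" "\<And>t. \<beta> < 0 \<Longrightarrow> u t \<noteq> 0" for \<beta> u
    using that by (cases "\<beta> > 0") (auto simp: g_def intro!: holomorphic_intros)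
  have pw: "cmod (g \<beta> u t) powr \<bar>\<beta>\<bar> = cmod (u t) powr \<beta>" if "\<beta> \<noteq> 0" for \<beta> u t
    using that by (auto simp: g_def norm_inverse powr_minus inverse_powr)
  have g0: "g \<beta> u t = 0 \<longleftrightarrow> u t = 0" for \<beta> u t by (simp add: g_def)
  have bd: "cmod (g \<beta>1 u1 t) powr \<bar>\<beta>1\<bar> * cmod (g \<beta>2 u2 t) powr \<bar>\<beta>2\<bar> \<le> C"
           "cmod (g \<beta>2 u2 t) powr \<bar>\<beta>2\<bar> * cmod (g \<beta>1 u1 t) powr \<bar>\<beta>1\<bar> \<le> C" for t
    using bound[of t] \<beta> by (simp_all add: pw mult.commute)
  note h1 = hol_g[OF hol(1) \<beta>(1) def1] and h2 = hol_g[OF hol(2) \<beta>(2) def2]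
  have "g \<beta>1 u1 z \<noteq> 0"
    by (rule bounded_weighted_product_zero_free[OF h1 h2 _ _ bd(1), of t0]) (use \<beta> t0 g0 in auto)
  moreover have "g \<beta>2 u2 z \<noteq> 0"
    by (rule bounded_weighted_product_zero_free[OF h2 h1 _ _ bd(2), of t0]) (use \<beta> t0 g0 in auto)
  moreover have "cmod (g \<beta>1 u1 z) powr \<bar>\<beta>1\<bar> * cmod (g \<beta>2 u2 z) powr \<bar>\<beta>2\<bar>
      = cmod (g \<beta>1 u1 t0) powr \<bar>\<beta>1\<bar> * cmod (g \<beta>2 u2 t0) powr \<bar>\<beta>2\<bar>"
    by (rule bounded_weighted_product_constant[OF h1 h2 _ _ bd(1)]) (use \<beta> t0 g0 in auto)
  ultimately show ?thesis using \<beta> by (simp add: g0 pw)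
qed

text \<open>The argument along one family of curves \<open>t \<mapsto> (a t\<^sup>m, b t\<^sup>n)\<close>. At \<open>t = 0\<close> the curve either leaves
  all compact subsets of the domain or extends to a point of the domain on an axis; the second
  alternative of the last hypothesis describes the latter.\<close>

lemma no_proper_map_rational_irrational_curve:
  fixes m n :: int
  assumes irr: "irrational_type \<beta>" and \<alpha>: "\<alpha> \<noteq> 0" and R: "R1 > 0" "r1 < R1"
    and proper: "proper_holomorphic_map (reinhardt_domain \<alpha> r1 R1) (reinhardt_domain \<beta> r2 R2) f"
    and mn: "\<alpha> $ 1 * of_int m + \<alpha> $ 2 * of_int n = 0"
    and outer: "escapes \<alpha> m n"
    and inner: "escapes \<alpha> (- m) (- n) \<or>
                (m \<ge> 0 \<and> \<alpha> $ 1 * of_int m = 0) \<and> (n \<ge> 0 \<and> \<alpha> $ 2 * of_int n = 0)"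
  shows False
proof -
  define D where "D = reinhardt_domain \<alpha> r1 R1"
  define T where "T = reinhardt_domain \<beta> r2 R2"
  have oD: "open D" by (simp add: D_def open_reinhardt_domain)
  have proper: "proper_holomorphic_map D T f" using proper by (simp add: D_def T_def)
  then have hol: "holomorphic_map_on f D" and fT: "\<And>z. z \<in> D \<Longrightarrow> f z \<in> T"
    and pre: "\<And>K. compact K \<Longrightarrow> K \<subseteq> T \<Longrightarrow> compact {z \<in> D. f z \<in> K}"
    by (auto simp: proper_holomorphic_map_def)
  have \<beta>2: "\<beta> $ 2 \<noteq> 0" "\<beta> $ 1 / \<beta> $ 2 \<notin> \<rat>" using irr by (auto simp: irrational_type_def)
  then have \<beta>1: "\<beta> $ 1 \<noteq> 0" by auto
  have abs\<beta>: "abs_monomial \<beta> w = cmod (w $ 1) powr (\<beta> $ 1) * cmod (w $ 2) powr (\<beta> $ 2)" for w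
    using \<beta>1 \<beta>2 by (simp add: abs_monomial_def rpow_def)
  have "D \<noteq> {}" using reinhardt_domain_exp_nonempty[OF \<alpha> R] unfolding D_def by blast
  have "\<exists>z\<in>D. z $ 1 \<noteq> 0 \<and> z $ 2 \<noteq> 0 \<and> f z $ 1 * f z $ 2 \<noteq> 0"
  proof (rule ccontr)
    assume "\<not> ?thesis"
    then have off: "\<And>z. z \<in> D \<Longrightarrow> z $ 1 \<noteq> 0 \<Longrightarrow> z $ 2 \<noteq> 0 \<Longrightarrow> f z $ 1 * f z $ 2 = 0" by blast
    have "continuous_on D (\<lambda>z. f z $ 1 * f z $ 2)"
      by (intro continuous_intros holomorphic_map_continuous_on hol)
    from constant_off_axes_imp_constant[OF oD this off]
    have "\<And>z. z \<in> D \<Longrightarrow> f z $ 1 * f z $ 2 = 0" by blast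
    then show False
      using no_proper_map_into_monomial_level[OF oD \<open>D \<noteq> {}\<close> proper, of 1 1 0] by simp
  qed
  then obtain z0 where z0: "z0 \<in> D" "z0 $ 1 \<noteq> 0" "z0 $ 2 \<noteq> 0" "f z0 $ 1 \<noteq> 0" "f z0 $ 2 \<noteq> 0" by auto
  define a b where "a = z0 $ 1" and "b = z0 $ 2"
  define \<xi> \<eta> where "\<xi> = Ln a" and "\<eta> = Ln b"
  have ab: "a = exp \<xi>" "b = exp \<eta>" "a \<noteq> 0" "b \<noteq> 0" using z0 by (auto simp: a_def b_def \<xi>_def \<eta>_def)
  define \<phi> where "\<phi> t = point2 (a * t powi m) (b * t powi n)" for t
  have \<phi>1: "\<phi> 1 = z0" by (simp add: \<phi>_def a_def b_def)
  have \<phi>exp: "\<phi> (exp \<zeta>) = point2 (exp (\<xi> + of_int m * \<zeta>)) (exp (\<eta> + of_int n * \<zeta>))" for \<zeta>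
    by (simp add: \<phi>_def ab exp_power_int exp_add)
  have \<phi>expD: "\<phi> (exp \<zeta>) \<in> D" for \<zeta>
  proof -
    have "\<alpha> $ 1 * Re (\<xi> + of_int m * \<zeta>) + \<alpha> $ 2 * Re (\<eta> + of_int n * \<zeta>)
        = \<alpha> $ 1 * Re \<xi> + \<alpha> $ 2 * Re \<eta> + (\<alpha> $ 1 * of_int m + \<alpha> $ 2 * of_int n) * Re \<zeta>"
      by (simp add: algebra_simps)
    then show ?thesis
      using z0(1) unfolding \<phi>1[symmetric] exp_zero[symmetric] \<phi>exp D_def exp_in_reinhardt_domain_iff mn
      by simp
  qed
  have \<phi>D: "\<phi> t \<in> D" if "t \<noteq> 0" for t using \<phi>expD[of "Ln t"] that by simp
  define u where "u i t = f (\<phi> t) $ i" for i t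
  have holu: "u i holomorphic_on - {0}" for i
    unfolding u_def \<phi>_def
    by (intro holomorphic_along_curve[OF hol oD] holomorphic_intros \<phi>D[unfolded \<phi>_def]) auto
  have holue: "(\<lambda>\<zeta>. u i (exp \<zeta>)) holomorphic_on UNIV" for i
  proof -
    have "exp ` (UNIV :: complex set) \<subseteq> - {0}" by auto
    then show ?thesis
      using holomorphic_on_compose_gen[OF holomorphic_on_exp holu[of i], of UNIV] by (simp add: o_def)
  qed
  have fT': "f (\<phi> (exp \<zeta>)) \<in> T" for \<zeta> using \<phi>expD fT by blast
  \<comment> \<open>The exponential pulls the curve back to an entire one.\<close>
  have const: "u 1 t \<noteq> 0 \<and> u 2 t \<noteq> 0 \<and> cmod (u 1 t) powr (\<beta> $ 1) * cmod (u 2 t) powr (\<beta> $ 2)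
      = cmod (u 1 1) powr (\<beta> $ 1) * cmod (u 2 1) powr (\<beta> $ 2)" if "t \<noteq> 0" for t
  proof -
    have "u 1 (exp (Ln t)) \<noteq> 0 \<and> u 2 (exp (Ln t)) \<noteq> 0 \<and>
       cmod (u 1 (exp (Ln t))) powr (\<beta> $ 1) * cmod (u 2 (exp (Ln t))) powr (\<beta> $ 2)
      = cmod (u 1 (exp 0)) powr (\<beta> $ 1) * cmod (u 2 (exp 0)) powr (\<beta> $ 2)"
    proof (rule bounded_monomial_along_entire_curve[OF holue holue \<beta>1 \<beta>2(1)])
      show "u 1 (exp \<zeta>) \<noteq> 0" if "\<beta> $ 1 < 0" for \<zeta>
        using fT'[of \<zeta>] that by (auto simp: T_def reinhardt_domain_def monomial_defined_def u_def)
      show "u 2 (exp \<zeta>) \<noteq> 0" if "\<beta> $ 2 < 0" for \<zeta>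
        using fT'[of \<zeta>] that by (auto simp: T_def reinhardt_domain_def monomial_defined_def u_def)
      show "cmod (u 1 (exp \<zeta>)) powr (\<beta> $ 1) * cmod (u 2 (exp \<zeta>)) powr (\<beta> $ 2) \<le> R2" for \<zeta>
        using fT'[of \<zeta>] by (simp add: T_def reinhardt_domain_def abs\<beta> u_def)
    qed (use z0 in \<open>auto simp: u_def \<phi>1\<close>)
    then show ?thesis using that by simp
  qed
  \<comment> \<open>\<open>f\<close> is proper over the torus through \<open>f z0\<close>, which lies in a level set of the monomial.\<close>
  define A where "A i = cmod (u i 1)" for i
  have A: "A 1 > 0" "A 2 > 0" using const[of 1] by (auto simp: A_def)
  define K where "K = {w :: complex^2. cmod (w $ 1) = A 1 \<and> cmod (w $ 2) = A 2}"
  have "compact K"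
    unfolding compact_eq_bounded_closed
  proof
    show "closed K" unfolding K_def
      by (intro closed_Collect_conj closed_Collect_eq continuous_intros)
    have "norm w \<le> A 1 + A 2" if "w \<in> K" for w
    proof -
      have "norm w \<le> (\<Sum>j\<in>UNIV. cmod (w $ j))"
        unfolding norm_vec_def by (rule L2_set_le_sum) simp
      then show ?thesis using that by (simp add: K_def sum_2)
    qed
    then show "bounded K" by (auto simp: bounded_iff)
  qed
  moreover have "K \<subseteq> T"
  proof
    fix w assume w: "w \<in> K"
    have "w $ 1 \<noteq> 0" "w $ 2 \<noteq> 0" using w A by (auto simp: K_def)
    moreover have "abs_monomial \<beta> w = abs_monomial \<beta> (f z0)"
      using w by (simp add: abs\<beta> K_def A_def u_def \<phi>1)
    ultimately show "w \<in> T"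
      using fT[OF z0(1)] by (auto simp: T_def reinhardt_domain_def monomial_defined_def forall_2)
  qed
  ultimately have K': "compact {z \<in> D. f z \<in> K}" by (rule pre)
  have inK: "\<phi> t \<in> {z \<in> D. f z \<in> K}" if "t \<noteq> 0" "cmod (u 1 t) = A 1" for t
  proof -
    have "cmod (u 2 t) powr (\<beta> $ 2) = A 2 powr (\<beta> $ 2)"
      using const[OF that(1)] that(2) A by (simp add: A_def)
    then have "(cmod (u 2 t) powr (\<beta> $ 2)) powr (1 / \<beta> $ 2) = (A 2 powr (\<beta> $ 2)) powr (1 / \<beta> $ 2)"
      by simp
    then have "cmod (u 2 t) = A 2" using \<beta>2 A const[OF that(1)] by (simp add: powr_powr)
    then show ?thesis using that \<phi>D by (simp add: K_def u_def)
  qed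
  have sub: "{z \<in> D. f z \<in> K} \<subseteq> reinhardt_domain \<alpha> r1 R1" by (auto simp: D_def)
  obtain M where M: "M > 0" "\<And>t. cmod t > M \<Longrightarrow> \<phi> t \<notin> {z \<in> D. f z \<in> K}"
    using escapes_leaves_compact[OF K' sub ab(3,4) outer] unfolding \<phi>_def by blast
  have out: "cmod (u 1 t) \<noteq> A 1" if "cmod t > M" for t
  proof -
    have "t \<noteq> 0" using that M(1) by auto
    then show ?thesis using M(2)[OF that] inK[of t] by blast
  qed
  have inn: "(\<exists>l. u 1 \<midarrow>0\<rightarrow> l) \<or> (\<exists>\<mu>>0. \<forall>t. t \<noteq> 0 \<longrightarrow> cmod t < \<mu> \<longrightarrow> cmod (u 1 t) \<noteq> A 1)"
    using inner
  proof
    assume "escapes \<alpha> (- m) (- n)"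
    then obtain M' where M': "M' > 0"
      "\<And>t. cmod t > M' \<Longrightarrow> point2 (a * t powi - m) (b * t powi - n) \<notin> {z \<in> D. f z \<in> K}"
      using escapes_leaves_compact[OF K' sub ab(3,4)] by blast
    have "cmod (u 1 t) \<noteq> A 1" if t: "t \<noteq> 0" "cmod t < 1 / M'" for t
    proof -
      have "cmod (inverse t) > M'" using M'(1) t by (auto simp: norm_inverse norm_divide field_simps)
      from M'(2)[OF this] have "\<phi> t \<notin> {z \<in> D. f z \<in> K}"
        by (simp add: \<phi>_def power_int_minus power_int_inverse)
      then show ?thesis using inK[of t] t by blast
    qed
    then show ?thesis using M'(1) by (intro disjI2 exI[of _ "1 / M'"]) auto
  next
    assume *: "(m \<ge> 0 \<and> \<alpha> $ 1 * of_int m = 0) \<and> (n \<ge> 0 \<and> \<alpha> $ 2 * of_int n = 0)"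
    have "(\<phi> \<longlongrightarrow> \<phi> 0) (at 0)"
      unfolding \<phi>_def using * by (intro tendsto_intros) auto
    have "monomial_defined \<alpha> (\<phi> 0)"
      using * z0(1) ab
      by (auto simp: D_def reinhardt_domain_def monomial_defined_def forall_2 \<phi>_def power_int_0_left_if)
    moreover have "abs_monomial \<alpha> (\<phi> 0) = abs_monomial \<alpha> z0"
      using * by (auto simp: abs_monomial_def \<phi>_def rpow_def power_int_0_left_if a_def b_def)
    ultimately have "\<phi> 0 \<in> D" using z0(1) by (simp add: D_def reinhardt_domain_def)
    then have "isCont f (\<phi> 0)"
      using holomorphic_map_continuous_on[OF hol] oD by (simp add: continuous_on_eq_continuous_at)
    then have "((\<lambda>t. f (\<phi> t)) \<longlongrightarrow> f (\<phi> 0)) (at 0)"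
      using \<open>(\<phi> \<longlongrightarrow> \<phi> 0) (at 0)\<close> by (rule isCont_tendsto_compose)
    then have "u 1 \<midarrow>0\<rightarrow> f (\<phi> 0) $ 1" unfolding u_def by (rule tendsto_vec_nth)
    then show ?thesis by blast
  qed
  obtain l where l: "\<And>t. t \<noteq> 0 \<Longrightarrow> u 1 t = l"
  proof (rule balanced_pair_constant[OF holu[of 1] holu[of 2] _ A _ \<beta>2 M(1) out inn])
    show "u 1 t \<noteq> 0 \<and> u 2 t \<noteq> 0" if "t \<noteq> 0" for t
      using const[OF that] by blast
    show "cmod (u 1 t) powr (\<beta> $ 1) * cmod (u 2 t) powr (\<beta> $ 2)
        = A 1 powr (\<beta> $ 1) * A 2 powr (\<beta> $ 2)" if "t \<noteq> 0" for t
      unfolding A_def using const[OF that] by blast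
  qed (blast intro: that)+
  have "cmod (of_real (M + 1) :: complex) > M" using M(1) by simp
  from out[OF this] show False
    using l[of 1] l[of "of_real (M + 1)"] M(1) by (simp add: A_def del: of_real_add)
qed

text \<open>If an exponent of \<open>\<alpha>\<close> vanishes, the coordinate lines are used instead of
  \<open>(a t\<^sup>q, b t\<^bsup>-p\<^esup>)\<close>: for one sign of the other exponent this curve tends to a point of the domain
  as \<open>t\<close> tends to infinity, while the coordinate lines have this extension point at \<open>t = 0\<close>.\<close>

lemma no_proper_map_rational_irrational:
  assumes rat: "rational_type \<alpha>" and irr: "irrational_type \<beta>" and \<alpha>: "\<alpha> \<noteq> 0"
    and R: "R1 > 0" "r1 < R1"
    and proper: "proper_holomorphic_map (reinhardt_domain \<alpha> r1 R1) (reinhardt_domain \<beta> r2 R2) f"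
  shows False
proof -
  obtain s p q where s: "s > 0" and pq: "\<alpha> $ 1 = s * of_int p" "\<alpha> $ 2 = s * of_int q"
      "p \<noteq> 0 \<or> q \<noteq> 0"
    using rational_type_integer_exponents[OF rat \<alpha>] .
  note curve = no_proper_map_rational_irrational_curve[OF irr \<alpha> R proper]
  consider "q = 0" | "p = 0" | "p \<noteq> 0" "q \<noteq> 0" by blast
  then show False
  proof cases
    case 1
    show False by (rule curve[of 0 1]) (use 1 pq in \<open>auto simp: escapes_def\<close>)
  next
    case 2
    show False by (rule curve[of 1 0]) (use 2 pq in \<open>auto simp: escapes_def\<close>)
  next
    case 3
    show False
    proof (rule curve[of q "- p"])
      show "escapes \<alpha> q (- p)"
        using 3 s unfolding escapes_def pq by (auto simp: mult_less_0_iff)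
      show "escapes \<alpha> (- q) (- (- p)) \<or>
          (q \<ge> 0 \<and> \<alpha> $ 1 * of_int q = 0) \<and> (- p \<ge> 0 \<and> \<alpha> $ 2 * of_int (- p) = 0)"
        using 3 s unfolding escapes_def pq by (auto simp: mult_less_0_iff)
    qed (simp add: pq)
  qed
qed

section \<open>Maps between domains of different types\<close>

theorem theorem5:
  fixes \<alpha> \<beta> :: "real^2" and r1 R1 r2 R2 :: real
  assumes "\<alpha> \<noteq> 0" and "\<beta> \<noteq> 0"
    and "R1 > 0" and "r1 < R1"
    and "R2 > 0" and "r2 < R2"
    and "(rational_type \<alpha> \<and> irrational_type \<beta>) \<or> (irrational_type \<alpha> \<and> rational_type \<beta>)"
  shows "\<not> (\<exists>f. proper_holomorphic_map (reinhardt_domain \<alpha> r1 R1) (reinhardt_domain \<beta> r2 R2) f)"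
proof
  assume "\<exists>f. proper_holomorphic_map (reinhardt_domain \<alpha> r1 R1) (reinhardt_domain \<beta> r2 R2) f"
  then obtain f where
    f: "proper_holomorphic_map (reinhardt_domain \<alpha> r1 R1) (reinhardt_domain \<beta> r2 R2) f" by blast
  from assms(7) show False
  proof (elim disjE conjE)
    assume "rational_type \<alpha>" "irrational_type \<beta>"
    then show False by (rule no_proper_map_rational_irrational[OF _ _ assms(1,3,4) f])
  next
    assume "irrational_type \<alpha>" "rational_type \<beta>"
    then show False by (rule no_proper_map_irrational_rational[OF _ _ assms(1,2,3,4) f])
  qed
qed

end
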